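(* Let $A_2,A_3\subset[0,1]$ be closed sets such that $A_2$ is $\times 2 \bmod 1$ invariant and $A_3$ is $\times 3\bmod 1$ invariant, and assume $\dim_{\mathrm H}A_2+\dim_{\mathrm H}A_3<1$. For real numbers $u\neq 0$ and $v$ put $l_{u,v}=A_2\cap(uA_3+v)\subset\mathbb{R}$. Then for every $u\ne0$, $v\in\mathbb{R}$ and every $a\in l_{u,v}$, the set $l_{u,v}$ is super sparse near $a$. Moreover the estimate is uniform: for every $\gamma>0$ and every $\varepsilon>0$ there is $N_0\in\mathbb{N}$ such that for all $u$ with $|u|\in(\gamma,\gamma^{-1})$, all $v\in\mathbb{R}$, all $a\in l_{u,v}$, all $k\in\mathbb{N}$ and all $N\ge N_0$, \[ \#\big(W(l_{u,v},a)\cap[k+1,k+N]\big)\le \varepsilon N . \]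
   Context: A closed set $A\subset[0,1]$ is called $\times p\bmod 1$ invariant ($p\ge2$ an integer) if $\{pa\}\in A$ for every $a\in A$, where $\{x\}$ denotes the fractional part. $\dim_{\mathrm H}$ is Hausdorff dimension. For a compact set $l\subset\mathbb{R}$ let $W(l)=\{k\in\mathbb{N}: l\cap([2^{-k-1},2^{-k}]\cup[-2^{-k},-2^{-k-1}])\neq\emptyset\}$, and for $a\in l$ let $W(l,a)=W(l-a)$ (the sparse index of $l$ near $a$). The upper natural density of $W\subset\mathbb{N}$ is $\limsup_{n\to\infty}\#(W\cap[1,n])/n$ and its upper Banach density is $\limsup_{N\to\infty}\sup_{k\in\mathbb{N}}\#(W\cap[k+1,k+N])/N$. The set $l$ is sparse near $a$ if $W(l,a)$ has upper natural density $0$ and super sparse near $a$ if $W(l,a)$ has upper Banach density $0$. *)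

theory Defs
  imports "HOL-Analysis.Analysis"
begin

text \<open>delta-approximating s-dimensional Hausdorff content: infimum over countable
  covers by bounded sets of diameter at most delta.  (Bounded is required because the
  library's diameter of an unbounded set is 0.)\<close>
definition hausdorff_content :: "real \<Rightarrow> real \<Rightarrow> real set \<Rightarrow> ennreal" where
  "hausdorff_content s \<delta> A =
     (INF U \<in> {U :: nat \<Rightarrow> real set. A \<subseteq> (\<Union>i. U i) \<and>
                   (\<forall>i. bounded (U i) \<and> diameter (U i) \<le> \<delta>)}.
        (\<Sum>i. ennreal (diameter (U i) powr s)))"

definition hausdorff_measure :: "real \<Rightarrow> real set \<Rightarrow> ennreal" where
  "hausdorff_measure s A = (SUP \<delta> \<in> {0<..}. hausdorff_content s \<delta> A)"

definition hausdorff_dim :: "real set \<Rightarrow> real" where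
  "hausdorff_dim A = Inf {s. 0 < s \<and> hausdorff_measure s A = 0}"

definition times_p_invariant :: "nat \<Rightarrow> real set \<Rightarrow> bool" where
  "times_p_invariant p A \<longleftrightarrow> A \<subseteq> {0..1} \<and> closed A \<and> (\<forall>a\<in>A. frac (real p * a) \<in> A)"

definition sparse_index :: "real set \<Rightarrow> nat set" where
  "sparse_index l = {k. 1 \<le> k \<and>
     l \<inter> ({(1/2) ^ (k+1) .. (1/2) ^ k} \<union> {- ((1/2) ^ k) .. - ((1/2) ^ (k+1))}) \<noteq> {}}"

definition sparse_index_at :: "real set \<Rightarrow> real \<Rightarrow> nat set" where
  "sparse_index_at l a = sparse_index ((\<lambda>x. x - a) ` l)"

definition upper_banach_density :: "nat set \<Rightarrow> ereal" where
  "upper_banach_density W =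
     limsup (\<lambda>N. ereal (SUP k. real (card (W \<inter> {k+1..k+N})) / real N))"

definition super_sparse_near :: "real set \<Rightarrow> real \<Rightarrow> bool" where
  "super_sparse_near l a \<longleftrightarrow> upper_banach_density (sparse_index_at l a) = 0"

definition slice :: "real set \<Rightarrow> real set \<Rightarrow> real \<Rightarrow> real \<Rightarrow> real set" where
  "slice A2 A3 u v = A2 \<inter> (\<lambda>x. u * x + v) ` A3"

end

theory Submission
  imports Defs
begin

text \<open>Rescaling around a point of a slice at scale \<open>2\<^sup>-\<^sup>m\<close> replaces the slope \<open>u\<close> by
  \<open>u 2\<^sup>m / 3\<^sup>q\<close> with \<open>3\<^sup>q \<le> 2\<^sup>m < 3\<^sup>q\<^sup>+\<^sup>1\<close>, i.e. it rotates the logarithm of the slope by the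
  irrational angle \<open>log 3 2\<close>, while the point moves in \<open>A2 \<times> A3\<close> by digit shifts. If the point is
  known to precision \<open>2\<^sup>-\<^sup>n\<close> and \<open>m\<close> lies in the sparse index, the slope is determined, to precision
  \<open>2\<^sup>-\<^sup>n\<close>, by a second point of \<open>A2 \<times> A3\<close>, which leaves at most about
  \<open>2\<^sup>n\<^sup>s\<close> choices for some \<open>s < 1\<close>, since for invariant sets box counts are governed by the Hausdorff
  dimension. On the other hand, for suitable \<open>n\<close> the digit block of length \<open>n\<close> carries only \<open>o(n)\<close>
  bits of information about the angle at precision \<open>2\<^sup>-\<^sup>n\<close>: the angles seen by \<open>L\<close> successive blocks
  determine each other, so information about them is shared by all \<open>L\<close> blocks, and would make the
  entropy of the long block drop below \<open>L\<close> times that of a short one; this can happen only at boundedly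
  many of the lengths \<open>n, L n, L\<^sup>2 n, \<dots>\<close>. As the rotation is equidistributed, the angle carries
  about \<open>n\<close> bits, so the two facts bound the frequency of sparse-index times.\<close>

section \<open>Entropy of functions on a finite set\<close>

definition fcount :: "'w set \<Rightarrow> ('w \<Rightarrow> 'v) \<Rightarrow> 'v \<Rightarrow> nat" where
  "fcount \<Omega> f v = card {\<omega>\<in>\<Omega>. f \<omega> = v}"

text \<open>\<open>ent\<close> is \<open>card \<Omega>\<close> times the Shannon entropy (in bits) of \<open>f\<close> under the uniform
  distribution on \<open>\<Omega>\<close>.\<close>
definition ent :: "'w set \<Rightarrow> ('w \<Rightarrow> 'v) \<Rightarrow> real" where
  "ent \<Omega> f = (\<Sum>\<omega>\<in>\<Omega>. log 2 (real (card \<Omega>) / real (fcount \<Omega> f (f \<omega>))))"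

lemma fcount_pos: "finite \<Omega> \<Longrightarrow> \<omega> \<in> \<Omega> \<Longrightarrow> 0 < fcount \<Omega> f (f \<omega>)"
  unfolding fcount_def by (auto simp: card_gt_0_iff)

lemma fcount_le_card: "finite \<Omega> \<Longrightarrow> fcount \<Omega> f v \<le> card \<Omega>"
  unfolding fcount_def by (auto intro: card_mono)

lemma sum_over_values:
  fixes r :: "'v \<Rightarrow> real"
  assumes "finite \<Omega>"
  shows "(\<Sum>\<omega>\<in>\<Omega>. r (f \<omega>) / real (fcount \<Omega> f (f \<omega>))) = (\<Sum>v\<in>f ` \<Omega>. r v)"
proof -
  have "(\<Sum>\<omega>\<in>\<Omega>. r (f \<omega>) / real (fcount \<Omega> f (f \<omega>)))
      = (\<Sum>v\<in>f ` \<Omega>. \<Sum>\<omega>\<in>{\<omega>. \<omega> \<in> \<Omega> \<and> f \<omega> = v}. r (f \<omega>) / real (fcount \<Omega> f (f \<omega>)))"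
    by (rule sum.image_gen[OF assms])
  also have "\<dots> = (\<Sum>v\<in>f ` \<Omega>. r v)"
  proof (rule sum.cong[OF refl])
    fix v assume v: "v \<in> f ` \<Omega>"
    have pos: "0 < fcount \<Omega> f v" using v assms fcount_pos[of \<Omega> _ f] by auto
    have "(\<Sum>\<omega>\<in>{\<omega>. \<omega> \<in> \<Omega> \<and> f \<omega> = v}. r (f \<omega>) / real (fcount \<Omega> f (f \<omega>)))
        = (\<Sum>\<omega>\<in>{\<omega>. \<omega> \<in> \<Omega> \<and> f \<omega> = v}. r v / real (fcount \<Omega> f v))"
      by (rule sum.cong) auto
    also have "\<dots> = r v" using pos by (simp add: fcount_def)
    finally show "(\<Sum>\<omega>\<in>{\<omega>. \<omega> \<in> \<Omega> \<and> f \<omega> = v}. r (f \<omega>) / real (fcount \<Omega> f (f \<omega>))) = r v" .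
  qed
  finally show ?thesis .
qed

text \<open>Pointwise \<open>ln x \<le> x - 1\<close>: divided by \<open>card \<Omega>\<close>, the
  weight \<open>r\<close> is a subprobability on the values of \<open>f\<close>. The entropy bounds
  for pairs and triples below come from suitable choices of \<open>r\<close>.\<close>

lemma gibbs_inequality:
  fixes r :: "'v \<Rightarrow> real"
  assumes fin: "finite \<Omega>" and pos: "\<And>\<omega>. \<omega> \<in> \<Omega> \<Longrightarrow> 0 < r (f \<omega>)"
    and le: "(\<Sum>v\<in>f ` \<Omega>. r v) \<le> real (card \<Omega>)"
  shows "(\<Sum>\<omega>\<in>\<Omega>. log 2 (r (f \<omega>) / real (fcount \<Omega> f (f \<omega>)))) \<le> 0"
proof -
  have "(\<Sum>\<omega>\<in>\<Omega>. ln (r (f \<omega>) / real (fcount \<Omega> f (f \<omega>))))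
      \<le> (\<Sum>\<omega>\<in>\<Omega>. r (f \<omega>) / real (fcount \<Omega> f (f \<omega>)) - 1)"
    by (intro sum_mono ln_le_minus_one divide_pos_pos) (auto simp: pos fin fcount_pos)
  also have "\<dots> \<le> 0"
    using le by (simp add: sum_subtractf sum_over_values[OF fin])
  finally show ?thesis
    by (simp add: log_def sum_divide_distrib[symmetric] divide_le_0_iff)
qed

lemma fcount_sum:
  assumes "finite \<Omega>"
  shows "(\<Sum>x\<in>f ` \<Omega>. fcount \<Omega> (\<lambda>\<omega>. (f \<omega>, c \<omega>)) (x, z)) = fcount \<Omega> c z"
proof -
  have "fcount \<Omega> c z = card (\<Union>x\<in>f ` \<Omega>. {\<omega>\<in>\<Omega>. (f \<omega>, c \<omega>) = (x, z)})"
    unfolding fcount_def by (rule arg_cong[where f = card]) auto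
  also have "\<dots> = (\<Sum>x\<in>f ` \<Omega>. card {\<omega>\<in>\<Omega>. (f \<omega>, c \<omega>) = (x, z)})"
    by (rule card_UN_disjoint) (use assms in auto)
  finally show ?thesis by (simp add: fcount_def)
qed

lemma sum_fcount_image:
  assumes "finite \<Omega>"
  shows "(\<Sum>x\<in>f ` \<Omega>. real (fcount \<Omega> f x)) = real (card \<Omega>)"
  using sum_over_values[OF assms, of "\<lambda>v. real (fcount \<Omega> f v)" f] fcount_pos[OF assms, of _ f]
  by (simp add: less_imp_neq[symmetric] cong: sum.cong)

text \<open>Gibbs with the weight that makes \<open>f\<close> and \<open>g\<close> conditionally
  independent given \<open>c\<close>; in other words, conditional mutual information is
  nonnegative.\<close>

lemma ent_submodular:
  assumes fin: "finite \<Omega>"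
  shows "ent \<Omega> (\<lambda>\<omega>. (f \<omega>, g \<omega>, c \<omega>)) + ent \<Omega> c
       \<le> ent \<Omega> (\<lambda>\<omega>. (f \<omega>, c \<omega>)) + ent \<Omega> (\<lambda>\<omega>. (g \<omega>, c \<omega>))"
proof -
  define F where "F = (\<lambda>\<omega>. (f \<omega>, g \<omega>, c \<omega>))"
  define fc where "fc = (\<lambda>\<omega>. (f \<omega>, c \<omega>))"
  define gc where "gc = (\<lambda>\<omega>. (g \<omega>, c \<omega>))"
  define r where "r = (\<lambda>(x, y, z). real (fcount \<Omega> fc (x, z)) * real (fcount \<Omega> gc (y, z)) / real (fcount \<Omega> c z))"
  note pos = fcount_pos[OF fin]
  \<comment> \<open>On the full product of the images the weight factorises for each fixed value of
    \<open>c\<close>, so its total is exactly \<open>card \<Omega>\<close>.\<close>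
  have "(\<Sum>v\<in>F ` \<Omega>. r v) \<le> (\<Sum>v\<in>(f ` \<Omega>) \<times> (g ` \<Omega>) \<times> (c ` \<Omega>). r v)"
    by (rule sum_mono2) (use fin in \<open>auto simp: F_def r_def\<close>)
  also have "\<dots> = (\<Sum>x\<in>f ` \<Omega>. \<Sum>y\<in>g ` \<Omega>. \<Sum>z\<in>c ` \<Omega>. r (x, y, z))"
    by (simp add: sum.cartesian_product split_def)
  also have "\<dots> = (\<Sum>x\<in>f ` \<Omega>. \<Sum>z\<in>c ` \<Omega>. \<Sum>y\<in>g ` \<Omega>. r (x, y, z))"
    by (intro sum.cong refl sum.swap)
  also have "\<dots> = (\<Sum>z\<in>c ` \<Omega>. \<Sum>x\<in>f ` \<Omega>. \<Sum>y\<in>g ` \<Omega>. r (x, y, z))"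
    by (rule sum.swap)
  also have "\<dots> = (\<Sum>z\<in>c ` \<Omega>. real (fcount \<Omega> c z))"
  proof (rule sum.cong[OF refl])
    fix z assume "z \<in> c ` \<Omega>"
    then have p: "0 < fcount \<Omega> c z" using pos[of _ c] by auto
    have s1: "(\<Sum>x\<in>f ` \<Omega>. real (fcount \<Omega> fc (x, z))) = real (fcount \<Omega> c z)"
      unfolding fc_def fcount_sum[OF fin, symmetric, of c z f] by simp
    have s2: "(\<Sum>y\<in>g ` \<Omega>. real (fcount \<Omega> gc (y, z))) = real (fcount \<Omega> c z)"
      unfolding gc_def fcount_sum[OF fin, symmetric, of c z g] by simp
    have "(\<Sum>x\<in>f ` \<Omega>. \<Sum>y\<in>g ` \<Omega>. r (x, y, z))
       = (\<Sum>x\<in>f ` \<Omega>. real (fcount \<Omega> fc (x, z))) * (\<Sum>y\<in>g ` \<Omega>. real (fcount \<Omega> gc (y, z))) / real (fcount \<Omega> c z)"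
      by (simp add: r_def sum_product sum_divide_distrib)
    then show "(\<Sum>x\<in>f ` \<Omega>. \<Sum>y\<in>g ` \<Omega>. r (x, y, z)) = real (fcount \<Omega> c z)"
      using p by (simp add: s1 s2)
  qed
  also have "\<dots> = real (card \<Omega>)"
    by (rule sum_fcount_image[OF fin])
  finally have le: "(\<Sum>v\<in>F ` \<Omega>. r v) \<le> real (card \<Omega>)" .
  have p2: "0 < r (F \<omega>)" if "\<omega> \<in> \<Omega>" for \<omega>
    using pos[OF that, of fc] pos[OF that, of gc] pos[OF that, of c]
    by (simp add: r_def F_def fc_def gc_def)
  have gibbs: "(\<Sum>\<omega>\<in>\<Omega>. log 2 (r (F \<omega>) / real (fcount \<Omega> F (F \<omega>)))) \<le> 0"
    by (rule gibbs_inequality[OF fin p2 le])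
  have "log 2 (r (F \<omega>) / real (fcount \<Omega> F (F \<omega>)))
      = log 2 (real (card \<Omega>) / real (fcount \<Omega> F (F \<omega>))) + log 2 (real (card \<Omega>) / real (fcount \<Omega> c (c \<omega>)))
       - log 2 (real (card \<Omega>) / real (fcount \<Omega> fc (fc \<omega>))) - log 2 (real (card \<Omega>) / real (fcount \<Omega> gc (gc \<omega>)))"
    if "\<omega> \<in> \<Omega>" for \<omega>
  proof -
    have "0 < card \<Omega>" using that fin by (auto simp: card_gt_0_iff)
    moreover have "r (F \<omega>) = real (fcount \<Omega> fc (fc \<omega>)) * real (fcount \<Omega> gc (gc \<omega>)) / real (fcount \<Omega> c (c \<omega>))"
      by (simp add: r_def F_def fc_def gc_def)
    ultimately show ?thesis
      using pos[OF that, of fc] pos[OF that, of gc] pos[OF that, of c] pos[OF that, of F]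
      by (simp add: log_mult log_divide)
  qed
  then have "(\<Sum>\<omega>\<in>\<Omega>. log 2 (r (F \<omega>) / real (fcount \<Omega> F (F \<omega>))))
    = ent \<Omega> F + ent \<Omega> c - ent \<Omega> fc - ent \<Omega> gc"
    unfolding ent_def by (simp add: sum.distrib sum_subtractf)
  with gibbs show ?thesis
    unfolding F_def fc_def gc_def by linarith
qed

text \<open>Gibbs with the weight that spreads the mass of each fibre of \<open>g\<close> evenly
  over the values taken by \<open>f\<close> there: conditional entropy is at most the logarithm of
  the conditional support.\<close>

lemma ent_pair_le_support:
  assumes fin: "finite \<Omega>"
  shows "ent \<Omega> (\<lambda>\<omega>. (f \<omega>, g \<omega>))
       \<le> ent \<Omega> g + (\<Sum>\<omega>\<in>\<Omega>. log 2 (real (card (f ` {\<omega>'\<in>\<Omega>. g \<omega>' = g \<omega>}))))"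
proof -
  define F where "F = (\<lambda>\<omega>. (f \<omega>, g \<omega>))"
  define S where "S = (\<lambda>y. f ` {\<omega>'\<in>\<Omega>. g \<omega>' = y})"
  define r where "r = (\<lambda>(x::'b, y). real (fcount \<Omega> g y) / real (card (S y)))"
  note pos = fcount_pos[OF fin]
  have Sfin: "finite (S y)" for y using fin by (simp add: S_def)
  have Spos: "0 < card (S (g \<omega>))" if "\<omega> \<in> \<Omega>" for \<omega>
    using that Sfin[of "g \<omega>"] by (auto simp: card_gt_0_iff S_def)
  have "F ` \<Omega> = (\<lambda>(y, x). (x, y)) ` (SIGMA y:g ` \<Omega>. S y)"
    by (auto simp: F_def S_def image_iff)
  then have "(\<Sum>v\<in>F ` \<Omega>. r v) = (\<Sum>p\<in>(SIGMA y:g ` \<Omega>. S y). r (snd p, fst p))"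
    by (simp add: sum.reindex inj_on_def split_def)
  also have "\<dots> = (\<Sum>y\<in>g ` \<Omega>. \<Sum>x\<in>S y. r (x, y))"
    using fin Sfin by (simp add: sum.Sigma split_def)
  also have "\<dots> = (\<Sum>y\<in>g ` \<Omega>. real (fcount \<Omega> g y))"
    using Spos by (intro sum.cong) (force simp: r_def)+
  also have "\<dots> = real (card \<Omega>)"
    by (rule sum_fcount_image[OF fin])
  finally have le: "(\<Sum>v\<in>F ` \<Omega>. r v) \<le> real (card \<Omega>)" by simp
  have p2: "0 < r (F \<omega>)" if "\<omega> \<in> \<Omega>" for \<omega>
    using pos[OF that, of g] Spos[OF that] by (simp add: r_def F_def)
  have gibbs: "(\<Sum>\<omega>\<in>\<Omega>. log 2 (r (F \<omega>) / real (fcount \<Omega> F (F \<omega>)))) \<le> 0"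
    by (rule gibbs_inequality[OF fin p2 le])
  have "log 2 (r (F \<omega>) / real (fcount \<Omega> F (F \<omega>)))
      = log 2 (real (card \<Omega>) / real (fcount \<Omega> F (F \<omega>))) 
       - log 2 (real (card \<Omega>) / real (fcount \<Omega> g (g \<omega>))) - log 2 (real (card (S (g \<omega>))))"
    if "\<omega> \<in> \<Omega>" for \<omega>
  proof -
    have "0 < card \<Omega>" using that fin by (auto simp: card_gt_0_iff)
    then show ?thesis
      using pos[OF that, of g] pos[OF that, of F] Spos[OF that]
      by (simp add: r_def F_def log_mult log_divide)
  qed
  then have "(\<Sum>\<omega>\<in>\<Omega>. log 2 (r (F \<omega>) / real (fcount \<Omega> F (F \<omega>))))
    = ent \<Omega> F - ent \<Omega> g - (\<Sum>\<omega>\<in>\<Omega>. log 2 (real (card (S (g \<omega>)))))"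
    unfolding ent_def by (simp add: sum.distrib sum_subtractf)
  with gibbs show ?thesis
    unfolding F_def S_def by linarith
qed

text \<open>Each fibre of \<open>g\<close> lies in a fibre of \<open>f\<close>, so the comparison is
  termwise. Besides discarding information, this serves to reorder and regroup tuples.\<close>

lemma ent_mono:
  assumes fin: "finite \<Omega>"
    and det: "\<And>\<omega> \<omega>'. \<omega> \<in> \<Omega> \<Longrightarrow> \<omega>' \<in> \<Omega> \<Longrightarrow> g \<omega>' = g \<omega> \<Longrightarrow> f \<omega>' = f \<omega>"
  shows "ent \<Omega> f \<le> ent \<Omega> g"
  unfolding ent_def
proof (rule sum_mono)
  fix \<omega> assume w: "\<omega> \<in> \<Omega>"
  have c: "0 < card \<Omega>" using w fin by (auto simp: card_gt_0_iff)
  have "fcount \<Omega> g (g \<omega>) \<le> fcount \<Omega> f (f \<omega>)"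
    unfolding fcount_def using det[OF w] fin by (intro card_mono) auto
  then show "log 2 (real (card \<Omega>) / real (fcount \<Omega> f (f \<omega>))) \<le> log 2 (real (card \<Omega>) / real (fcount \<Omega> g (g \<omega>)))"
    using fcount_pos[OF fin w, of f] fcount_pos[OF fin w, of g] c
    by (simp add: divide_left_mono)
qed

lemma ent_nonneg:
  assumes fin: "finite \<Omega>"
  shows "0 \<le> ent \<Omega> f"
  unfolding ent_def
proof (rule sum_nonneg)
  fix \<omega> assume w: "\<omega> \<in> \<Omega>"
  show "0 \<le> log 2 (real (card \<Omega>) / real (fcount \<Omega> f (f \<omega>)))"
    using fcount_pos[OF fin w, of f] fcount_le_card[OF fin, of f "f \<omega>"]
    by (simp add: zero_le_log_cancel_iff)
qed

lemma ent_bij: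
  assumes "bij_betw \<sigma> \<Omega> \<Omega>"
  shows "ent \<Omega> (\<lambda>\<omega>. f (\<sigma> \<omega>)) = ent \<Omega> f"
proof -
  have inj: "inj_on \<sigma> \<Omega>" and im: "\<sigma> ` \<Omega> = \<Omega>" using assms by (auto simp: bij_betw_def)
  have "fcount \<Omega> (\<lambda>\<omega>. f (\<sigma> \<omega>)) v = fcount \<Omega> f v" for v
  proof -
    have "\<sigma> ` {\<omega>\<in>\<Omega>. f (\<sigma> \<omega>) = v} = {\<omega>\<in>\<Omega>. f \<omega> = v}" using im by (auto simp: image_iff)
    then show ?thesis unfolding fcount_def
      by (metis (no_types, lifting) card_image inj inj_on_subset mem_Collect_eq subsetI)
  qed
  then show ?thesis unfolding ent_def
    using sum.reindex_bij_betw[OF assms, of "\<lambda>\<omega>. log 2 (real (card \<Omega>) / real (fcount \<Omega> f (f \<omega>)))"] by simp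
qed

lemma sum_log_support_le:
  assumes fin: "finite \<Omega>" and B: "1 \<le> B"
    and le: "\<And>\<omega>. \<omega> \<in> \<Omega> \<Longrightarrow> real (card (f ` {\<omega>'\<in>\<Omega>. g \<omega>' = g \<omega>})) \<le> B"
  shows "(\<Sum>\<omega>\<in>\<Omega>. log 2 (real (card (f ` {\<omega>'\<in>\<Omega>. g \<omega>' = g \<omega>})))) \<le> real (card \<Omega>) * log 2 B"
proof (rule order_trans[OF sum_mono])
  fix \<omega> assume w: "\<omega> \<in> \<Omega>"
  have "0 < card (f ` {\<omega>'\<in>\<Omega>. g \<omega>' = g \<omega>})" using w fin by (auto simp: card_gt_0_iff)
  then show "log 2 (real (card (f ` {\<omega>'\<in>\<Omega>. g \<omega>' = g \<omega>}))) \<le> log 2 B"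
    using le[OF w] by simp
qed simp

lemma ent_pair_le:
  assumes fin: "finite \<Omega>" and B: "1 \<le> B"
    and le: "\<And>\<omega>. \<omega> \<in> \<Omega> \<Longrightarrow> real (card (f ` {\<omega>'\<in>\<Omega>. g \<omega>' = g \<omega>})) \<le> B"
  shows "ent \<Omega> (\<lambda>\<omega>. (f \<omega>, g \<omega>)) \<le> ent \<Omega> g + real (card \<Omega>) * log 2 B"
  using ent_pair_le_support[OF fin, of f g] sum_log_support_le[OF fin B le] by linarith

lemma ent_le_log_card:
  assumes fin: "finite \<Omega>" and B: "1 \<le> B" and le: "real (card (f ` \<Omega>)) \<le> B"
  shows "ent \<Omega> f \<le> real (card \<Omega>) * log 2 B"
proof -
  have "ent \<Omega> f \<le> ent \<Omega> (\<lambda>\<omega>. (f \<omega>, ()))" by (rule ent_mono[OF fin]) auto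
  also have "\<dots> \<le> ent \<Omega> (\<lambda>_. ()) + real (card \<Omega>) * log 2 B"
    by (rule ent_pair_le[OF fin B]) (use le in auto)
  also have "ent \<Omega> (\<lambda>_. ()) = 0" by (simp add: ent_def fcount_def log_def)
  finally show ?thesis by simp
qed

text \<open>For support bounds that are good only on \<open>E\<close>. Revealing the indicator of
  \<open>E\<close> costs at most one bit per point, the summand \<open>card \<Omega>\<close>; after
  that \<open>B\<close> applies on \<open>E\<close> and \<open>B'\<close> off it.\<close>

lemma ent_pair_le_event:
  assumes fin: "finite \<Omega>" and EO: "E \<subseteq> \<Omega>" and B: "1 \<le> B" "1 \<le> B'"
    and le: "\<And>v. real (card (f ` {\<omega>\<in>E. g \<omega> = v})) \<le> B"
    and le': "real (card (f ` \<Omega>)) \<le> B'"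
  shows "ent \<Omega> (\<lambda>\<omega>. (f \<omega>, g \<omega>))
    \<le> ent \<Omega> g + real (card \<Omega>) + real (card E) * log 2 B + (real (card \<Omega>) - real (card E)) * log 2 B'"
proof -
  define e where "e = (\<lambda>\<omega>. \<omega> \<in> E)"
  have finE: "finite E" using fin EO finite_subset by blast
  have "card (e ` A) \<le> 2" for A
    using card_mono[of "UNIV :: bool set" "e ` A"] by simp
  then have "ent \<Omega> (\<lambda>\<omega>. (e \<omega>, g \<omega>)) \<le> ent \<Omega> g + real (card \<Omega>) * log 2 2"
    by (intro ent_pair_le[OF fin]) (auto simp: numeral_le_real_of_nat_iff)
  moreover have "ent \<Omega> (\<lambda>\<omega>. (f \<omega>, g \<omega>)) \<le> ent \<Omega> (\<lambda>\<omega>. (f \<omega>, e \<omega>, g \<omega>))"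
    by (rule ent_mono[OF fin]) auto
  moreover have "ent \<Omega> (\<lambda>\<omega>. (f \<omega>, e \<omega>, g \<omega>)) \<le> ent \<Omega> (\<lambda>\<omega>. (e \<omega>, g \<omega>)) +
      (\<Sum>\<omega>\<in>\<Omega>. log 2 (real (card (f ` {\<omega>'\<in>\<Omega>. (e \<omega>', g \<omega>') = (e \<omega>, g \<omega>)}))))"
    by (rule ent_pair_le_support[OF fin])
  moreover have "(\<Sum>\<omega>\<in>\<Omega>. log 2 (real (card (f ` {\<omega>'\<in>\<Omega>. (e \<omega>', g \<omega>') = (e \<omega>, g \<omega>)}))))
      \<le> (\<Sum>\<omega>\<in>\<Omega>. if \<omega> \<in> E then log 2 B else log 2 B')"
  proof (rule sum_mono)
    fix \<omega> assume w: "\<omega> \<in> \<Omega>"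
    let ?S = "f ` {\<omega>'\<in>\<Omega>. (e \<omega>', g \<omega>') = (e \<omega>, g \<omega>)}"
    have p: "0 < card ?S" using w fin by (auto simp: card_gt_0_iff)
    show "log 2 (real (card ?S)) \<le> (if \<omega> \<in> E then log 2 B else log 2 B')"
    proof (cases "\<omega> \<in> E")
      case True
      have "?S = f ` {\<omega>'\<in>E. g \<omega>' = g \<omega>}" using True EO by (auto simp: e_def)
      then have "real (card ?S) \<le> B" using le by simp
      then show ?thesis using True p by simp
    next
      case False
      have "card ?S \<le> card (f ` \<Omega>)" by (rule card_mono) (use fin in auto)
      then have "real (card ?S) \<le> B'" using le' by linarith
      then show ?thesis using False p by simp
    qed
  qed
  moreover have "(\<Sum>\<omega>\<in>\<Omega>. if \<omega> \<in> E then log 2 B else log 2 B')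
     = real (card E) * log 2 B + (real (card \<Omega>) - real (card E)) * log 2 B'"
  proof -
    have "\<Omega> \<inter> E = E" using EO by auto
    moreover have "\<Omega> \<inter> - E = \<Omega> - E" by auto
    ultimately show ?thesis
      using fin finE EO by (simp add: sum.If_cases card_Diff_subset card_mono of_nat_diff)
  qed
  ultimately show ?thesis by (simp add: algebra_simps)
qed

section \<open>Box counts of invariant sets\<close>

text \<open>The dimension is an \<open>Inf\<close> of reals, informative only over a nonempty set;
  the exponent 2 supplies a member. The reason is that K intervals of length 1/K have total mass
  1/K.\<close>

lemma hausdorff_measure_2_unit:
  assumes A: "A \<subseteq> {0..1::real}"
  shows "hausdorff_measure 2 A = 0"
proof -
  have "hausdorff_content 2 \<delta> A \<le> ennreal e" if d: "0 < \<delta>" and e: "0 < e" for \<delta> e :: real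
  proof -
    obtain n :: nat where n: "1 / real (Suc n) < min \<delta> e"
      using nat_approx_posE[of "min \<delta> e"] d e by auto
    define K where "K = Suc n"
    have K: "0 < K" "1 / real K < min \<delta> e" using n by (auto simp: K_def)
    define U where "U = (\<lambda>i. if i < K then {real i / real K .. (real i + 1) / real K} else {})"
    have diam: "diameter (U i) \<le> 1 / real K" for i
    proof (rule diameter_le)
      show "U i \<noteq> {} \<or> 0 \<le> 1 / real K" by simp
      fix x y assume "x \<in> U i" "y \<in> U i"
      then show "norm (x - y) \<le> 1 / real K"
        by (auto simp: U_def add_divide_distrib abs_le_iff split: if_splits)
    qed
    have cover: "A \<subseteq> (\<Union>i. U i)"
    proof
      fix x assume "x \<in> A"
      then have x: "0 \<le> x" "x \<le> 1" using A by auto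
      show "x \<in> (\<Union>i. U i)"
      proof (cases "x = 1")
        \<comment> \<open>The floor used below would give the index \<open>K\<close>, out of range;
          the end point goes to the last closed interval.\<close>
        case True
        then have "x \<in> U (K - 1)" using K by (simp add: U_def of_nat_diff)
        then show ?thesis by blast
      next
        case False
        define i where "i = nat \<lfloor>real K * x\<rfloor>"
        have i: "real i = of_int \<lfloor>real K * x\<rfloor>" using x by (simp add: i_def)
        have l: "real i \<le> real K * x" "real K * x < real i + 1" unfolding i by linarith+
        have "real K * x < real K" using x False K by simp
        then have "i < K" using l by linarith
        then have "x \<in> U i" using l K by (auto simp: U_def field_simps)
        then show ?thesis by blast
      qed
    qed
    have "U \<in> {U :: nat \<Rightarrow> real set. A \<subseteq> (\<Union>i. U i) \<and> (\<forall>i. bounded (U i) \<and> diameter (U i) \<le> \<delta>)}"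
    proof (intro CollectI conjI allI cover)
      show "bounded (U i)" for i by (simp add: U_def)
      show "diameter (U i) \<le> \<delta>" for i using diam[of i] K by linarith
    qed
    then have "hausdorff_content 2 \<delta> A \<le> (\<Sum>i. ennreal (diameter (U i) powr 2))"
      unfolding hausdorff_content_def by (rule INF_lower)
    also have "\<dots> = (\<Sum>i<K. ennreal (diameter (U i) powr 2))"
      by (rule suminf_finite) (auto simp: U_def)
    also have "\<dots> = ennreal (\<Sum>i<K. diameter (U i) powr 2)"
      by (rule sum_ennreal) auto
    also have "\<dots> \<le> ennreal e"
    proof (rule ennreal_leI)
      have "(\<Sum>i<K. diameter (U i) powr 2) \<le> (\<Sum>i<K. (1 / real K)\<^sup>2)"
      proof (rule sum_mono)
        fix i
        have "0 \<le> diameter (U i)" by (rule diameter_ge_0) (auto simp: U_def)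
        then show "diameter (U i) powr 2 \<le> (1 / real K)\<^sup>2"
          using diam[of i] by (simp add: powr_numeral power_mono del: power_divide power_one_over)
      qed
      also have "\<dots> = 1 / real K" using K by (simp add: power2_eq_square)
      finally show "(\<Sum>i<K. diameter (U i) powr 2) \<le> e" using K by linarith
    qed
    finally show ?thesis .
  qed
  then have "hausdorff_content 2 \<delta> A \<le> 0" if "0 < \<delta>" for \<delta>
    using that ennreal_le_epsilon[of 0 "hausdorff_content 2 \<delta> A"] by simp
  then show ?thesis
    unfolding hausdorff_measure_def by (metis SUP_least greaterThan_iff le_zero_eq)
qed

lemma hausdorff_dim_less_imp_null:
  assumes "A \<subseteq> {0..1}" and "hausdorff_dim A < s"
  obtains t where "0 < t" "t < s" "hausdorff_measure t A = 0"
proof -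
  have "{s. 0 < s \<and> hausdorff_measure s A = 0} \<noteq> {}"
    using hausdorff_measure_2_unit[OF assms(1)] by (auto intro!: exI[of _ 2])
  from cInf_lessD[OF this assms(2)[unfolded hausdorff_dim_def]] that show ?thesis by blast
qed

lemma card_int_close:
  fixes S :: "int set"
  assumes "\<And>a b. a \<in> S \<Longrightarrow> b \<in> S \<Longrightarrow> \<bar>a - b\<bar> \<le> int d"
  shows "finite S \<and> card S \<le> Suc d"
proof (cases "S = {}")
  case False
  then obtain a where a: "a \<in> S" by blast
  have "S \<subseteq> {a - int d..a + int d}"
  proof
    fix b assume "b \<in> S"
    then show "b \<in> {a - int d..a + int d}" using assms[OF a, of b] by (simp add: abs_le_iff)
  qed
  then have fin: "finite S" by (rule finite_subset) simp
  \<comment> \<open>The two-sided window was needed only for finiteness; measuring from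
    \<open>Min S\<close> improves the count to \<open>Suc d\<close>.\<close>
  have "S \<subseteq> {Min S..Min S + int d}"
  proof
    fix b assume b: "b \<in> S"
    have "Min S \<in> S" "Min S \<le> b" using b Min_in[OF fin False] fin by auto
    then show "b \<in> {Min S..Min S + int d}" using assms[OF b \<open>Min S \<in> S\<close>] by auto
  qed
  then have "card S \<le> card {Min S..Min S + int d}" by (rule card_mono[rotated]) simp
  then show ?thesis using fin by simp
qed simp

lemma powr_neg_mult_nat:
  assumes "0 < p"
  shows "real p powr - (s * real m) = (1 / real p ^ m) powr s"
proof -
  have "1 / real p ^ m = real p powr - real m"
    using assms by (simp add: powr_minus_divide powr_realpow)
  then show ?thesis by (simp add: powr_powr mult.commute)
qed

text \<open>The scale is the last one with p^-m above \<open>d\<close>, so that p^-m is at most p d.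
  For \<open>d = 0\<close> there is no last one, and the slack \<open>e\<close> pays for an
  arbitrarily fine scale.\<close>

lemma adic_scale:
  fixes d s e :: real
  assumes p: "2 \<le> p" and d: "0 \<le> d" "d < 1" and s: "0 < s" and e: "0 < e"
  obtains m :: nat where "d < 1 / real p ^ m" "real p powr - (s * real m) \<le> real p powr s * d powr s + e"
proof (cases "d = 0")
  case True
  have "0 < e powr (1 / s)" using e by simp
  then obtain m where m: "(1 / real p) ^ m < e powr (1 / s)"
    using real_arch_pow_inv[of "e powr (1/s)" "1 / real p"] p by auto
  have "real p powr - (s * real m) = ((1 / real p) ^ m) powr s"
    using powr_neg_mult_nat[of p s m] p by (simp add: power_one_over)
  also have "\<dots> \<le> (e powr (1 / s)) powr s"
    using m s p by (intro powr_mono2) auto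
  also have "\<dots> = e" using s e by (simp add: powr_powr)
  finally show ?thesis using that[of m] True s p by simp
next
  case False
  then have d0: "0 < d" using d by simp
  define k where "k = (LEAST k. (1 / real p) ^ k \<le> d)"
  have ex: "\<exists>k. (1 / real p) ^ k \<le> d"
    using real_arch_pow_inv[OF d0, of "1 / real p"] p by (auto intro: less_imp_le)
  then have k: "(1 / real p) ^ k \<le> d" unfolding k_def by (rule LeastI_ex)
  then have "k \<noteq> 0" using d by (cases k) auto
  then obtain m where m: "k = Suc m" by (cases k) auto
  then have "\<not> (1 / real p) ^ m \<le> d" using not_less_Least[of m "\<lambda>k. (1 / real p) ^ k \<le> d"] by (simp add: k_def)
  then have 1: "d < 1 / real p ^ m" by (simp add: power_one_over)
  have "1 / real p ^ m \<le> real p * d" using k p by (simp add: m power_one_over field_simps)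
  then have "(1 / real p ^ m) powr s \<le> (real p * d) powr s"
    using s by (intro powr_mono2) auto
  also have "\<dots> = real p powr s * d powr s" using p d by (simp add: powr_mult)
  also have "(1 / real p ^ m) powr s = real p powr - (s * real m)"
    using powr_neg_mult_nat[of p s m] p by simp
  finally show ?thesis using that[OF 1] e by simp
qed

text \<open>A set in which distances stay below p^-m meets at most two p-adic intervals of level m,
  so a cover of small s-mass becomes p-adic at the cost of a constant factor. Opening the cover sets
  slightly lets compactness make it finite.\<close>

lemma finite_adic_cover:
  fixes A :: "real set"
  assumes p: "2 \<le> p" and comp: "compact A" and s: "0 < s" and null: "hausdorff_measure s A = 0"
  obtains J :: "(nat \<times> int) set" and m :: "nat \<Rightarrow> nat" where "finite J"
    "\<forall>x\<in>A. \<exists>(i, c)\<in>J. \<lfloor>real p ^ m i * x\<rfloor> = c"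
    "(\<Sum>(i, c)\<in>J. real p powr - (s * real (m i))) < 1"
proof -
  \<comment> \<open>Chosen so that the final total 2 p^s e + 4 e is at most 1/4 + 1/2.\<close>
  define e where "e = 1 / (8 * real p powr s)"
  have ps: "1 \<le> real p powr s" using p s by (simp add: ge_one_powr_ge_zero)
  then have e: "0 < e" using p by (simp add: e_def)
  have "hausdorff_content s (1/2) A \<le> hausdorff_measure s A"
    unfolding hausdorff_measure_def
    using SUP_upper[of "1/2" "{0<..}" "\<lambda>\<delta>. hausdorff_content s \<delta> A"] by simp
  also have "\<dots> < ennreal e" using null e by simp
  finally have "hausdorff_content s (1/2) A < ennreal e" .
  then obtain U where U0: "U \<in> {U. A \<subseteq> (\<Union>i. U i) \<and> (\<forall>i. bounded (U i) \<and> diameter (U i) \<le> 1/2)}"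
    and Ue: "(\<Sum>i. ennreal (diameter (U i) powr s)) < ennreal e"
    unfolding hausdorff_content_def INF_less_iff by (elim bexE)
  have U: "A \<subseteq> (\<Union>i. U i)" "\<And>i. bounded (U i)" "\<And>i. diameter (U i) \<le> 1/2"
    using U0 by simp_all
  define d where "d = (\<lambda>i::nat. diameter (U i))"
  have d0: "0 \<le> d i" "d i < 1" for i
    using diameter_ge_0[OF U(2)[of i]] U(3)[of i] by (auto simp: d_def)
  have "\<exists>m. d i < 1 / real p ^ m \<and> real p powr - (s * real m) \<le> real p powr s * d i powr s + e * (1/2) ^ i" for i
  proof -
    have "0 < e * (1/2) ^ i" using e by simp
    from adic_scale[OF p d0(1)[of i] d0(2) s this] show ?thesis by blast
  qed
  then have "\<exists>m. \<forall>i. d i < 1 / real p ^ m i \<and> real p powr - (s * real (m i)) \<le> real p powr s * d i powr s + e * (1/2) ^ i"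
    by (intro choice allI)
  then obtain m where m: "\<And>i. d i < 1 / real p ^ m i"
      "\<And>i. real p powr - (s * real (m i)) \<le> real p powr s * d i powr s + e * (1/2) ^ i"
    by blast
  \<comment> \<open>Half of the gap for each end: points of the fattened set are still less than
    p^-(m i) apart.\<close>
  define \<eta> where "\<eta> = (\<lambda>i. (1 / real p ^ m i - d i) / 2)"
  have eta: "0 < \<eta> i" for i using m(1)[of i] by (simp add: \<eta>_def)
  define V where "V = (\<lambda>i. \<Union>y\<in>U i. ball y (\<eta> i))"
  have Vopen: "open (V i)" for i unfolding V_def by (intro open_UN ballI open_ball)
  have UV: "U i \<subseteq> V i" for i
  proof
    fix y assume "y \<in> U i"
    moreover have "y \<in> ball y (\<eta> i)" using eta by simp
    ultimately show "y \<in> V i" unfolding V_def by blast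
  qed
  have cov: "A \<subseteq> (\<Union>i\<in>UNIV. V i)" using U(1) UV by blast
  obtain I where "I \<subseteq> UNIV" and I: "finite I" "A \<subseteq> (\<Union>i\<in>I. V i)"
    by (rule compactE_image[OF comp Vopen cov])
  define T where "T = (\<lambda>i. (\<lambda>x. \<lfloor>real p ^ m i * x\<rfloor>) ` V i)"
  have T: "finite (T i) \<and> card (T i) \<le> Suc 1" for i
  proof (rule card_int_close)
    fix a b assume "a \<in> T i" "b \<in> T i"
    then obtain x x' y y' where *: "a = \<lfloor>real p ^ m i * x\<rfloor>" "b = \<lfloor>real p ^ m i * x'\<rfloor>"
      "y \<in> U i" "y' \<in> U i" "dist y x < \<eta> i" "dist y' x' < \<eta> i"
      unfolding T_def V_def by (elim imageE UN_E) (use mem_ball in blast)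
    have "dist y y' \<le> d i" unfolding d_def by (rule diameter_bounded_bound[OF U(2) *(3,4)])
    then have "\<bar>x - x'\<bar> < d i + 2 * \<eta> i" using *(5,6) by (simp add: dist_real_def)
    moreover have "d i + 2 * \<eta> i = 1 / real p ^ m i" by (simp add: \<eta>_def diff_divide_distrib)
    ultimately have "\<bar>x - x'\<bar> < 1 / real p ^ m i" by simp
    then have "real p ^ m i * \<bar>x - x'\<bar> < 1" using p by (simp add: field_simps)
    then have "\<bar>real p ^ m i * x - real p ^ m i * x'\<bar> < 1"
      by (simp add: right_diff_distrib[symmetric] abs_mult)
    then show "\<bar>a - b\<bar> \<le> int 1" unfolding * by linarith
  qed
  define J where "J = (SIGMA i:I. T i)"
  have finJ: "finite J" using I T by (auto simp: J_def)
  have coverJ: "\<exists>(i, c)\<in>J. \<lfloor>real p ^ m i * x\<rfloor> = c" if x: "x \<in> A" for x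
  proof -
    obtain i where i: "i \<in> I" "x \<in> V i" using x I(2) by blast
    then have "(i, \<lfloor>real p ^ m i * x\<rfloor>) \<in> J" by (simp add: J_def T_def)
    then show ?thesis by blast
  qed
  have "(\<Sum>(i, c)\<in>J. real p powr - (s * real (m i))) = (\<Sum>i\<in>I. \<Sum>c\<in>T i. real p powr - (s * real (m i)))"
    unfolding J_def by (rule sum.Sigma[symmetric]) (use I T in auto)
  also have "\<dots> \<le> (\<Sum>i\<in>I. 2 * (real p powr s * d i powr s + e * (1/2) ^ i))"
  proof (rule sum_mono)
    fix i
    have "(\<Sum>c\<in>T i. real p powr - (s * real (m i))) = real (card (T i)) * real p powr - (s * real (m i))" by simp
    also have "\<dots> \<le> 2 * (real p powr s * d i powr s + e * (1/2) ^ i)"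
      using T[of i] m(2)[of i] by (intro mult_mono) auto
    finally show "(\<Sum>c\<in>T i. real p powr - (s * real (m i))) \<le> 2 * (real p powr s * d i powr s + e * (1/2) ^ i)" .
  qed
  also have "\<dots> = 2 * real p powr s * (\<Sum>i\<in>I. d i powr s) + 2 * e * (\<Sum>i\<in>I. (1/2) ^ i)"
    by (simp add: sum.distrib sum_distrib_left algebra_simps)
  also have "\<dots> \<le> 2 * real p powr s * e + 2 * e * 2"
  proof -
    have "ennreal (\<Sum>i\<in>I. d i powr s) = (\<Sum>i\<in>I. ennreal (d i powr s))" by simp
    also have "\<dots> \<le> (\<Sum>i. ennreal (d i powr s))"
      by (rule sum_le_suminf) (use I in auto)
    also have "\<dots> < ennreal e" using Ue by (simp add: d_def)
    finally have 1: "(\<Sum>i\<in>I. d i powr s) \<le> e"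
      using e by (simp add: ennreal_less_iff sum_nonneg)
    have "(\<Sum>i\<in>I. (1/2::real) ^ i) \<le> (\<Sum>i. (1/2) ^ i)"
      by (rule sum_le_suminf) (use I in auto)
    then have 2: "(\<Sum>i\<in>I. (1/2::real) ^ i) \<le> 2" by (simp add: suminf_geometric)
    show ?thesis using 1 2 e ps by (intro add_mono mult_left_mono) auto
  qed
  also have "\<dots> < 1"
    using ps by (simp add: e_def field_simps)
  finally show ?thesis using that[OF finJ] coverJ by blast
qed

lemma frac_of_nat_mult_frac: "frac (real p * frac x) = frac (real p * x)"
proof -
  have "real p * frac x = real p * x - of_int (int p * \<lfloor>x\<rfloor>)"
    by (simp add: frac_def algebra_simps)
  then have "\<lfloor>real p * frac x\<rfloor> = \<lfloor>real p * x\<rfloor> - int p * \<lfloor>x\<rfloor>" by (simp only: floor_diff_of_int)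
  then show ?thesis unfolding frac_def by (simp add: right_diff_distrib)
qed

lemma times_p_invariant_power:
  assumes inv: "times_p_invariant p A" and x: "x \<in> A"
  shows "frac (real p ^ m * x) \<in> A"
proof (induction m)
  case 0
  show ?case
  proof (cases "x = 1")
    \<comment> \<open>The point 1 is the only one of the unit interval moved by \<open>frac\<close>;
      its image 0 is also \<open>frac (p * 1)\<close>, hence in \<open>A\<close> by
      invariance.\<close>
    case True
    have "frac (real p * x) \<in> A" using inv x by (auto simp: times_p_invariant_def)
    then show ?thesis using True by (simp add: frac_def)
  next
    case False
    then have "0 \<le> x" "x < 1" using inv x by (force simp: times_p_invariant_def)+
    then show ?thesis using x by (simp add: frac_eq)
  qed
next
  case (Suc m)
  then have "frac (real p * frac (real p ^ m * x)) \<in> A" using inv by (auto simp: times_p_invariant_def)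
  then show ?case by (simp add: frac_of_nat_mult_frac mult.assoc)
qed

text \<open>Invariance turns a finite cover by \<open>p\<close>-adic intervals of total \<open>s\<close>-mass below 1 into a
  renewal inequality for the box counts.\<close>
lemma box_count_bound:
  assumes p: "2 \<le> p" and inv: "times_p_invariant p A" and dim: "hausdorff_dim A < s"
  obtains C where "1 \<le> C"
    "\<And>n. real (card ((\<lambda>x. \<lfloor>real p ^ n * x\<rfloor>) ` A)) \<le> C * real p powr (s * real n)"
proof -
  have A01: "A \<subseteq> {0..1}" and "closed A" using inv by (auto simp: times_p_invariant_def)
  then have comp: "compact A" by (meson bounded_closed_interval bounded_subset compact_eq_bounded_closed)
  obtain t where t: "0 < t" "t < s" "hausdorff_measure t A = 0"
    using hausdorff_dim_less_imp_null[OF A01 dim] .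
  obtain J :: "(nat \<times> int) set" and m :: "nat \<Rightarrow> nat" where J: "finite J"
    "\<forall>x\<in>A. \<exists>(i, c)\<in>J. \<lfloor>real p ^ m i * x\<rfloor> = c"
    "(\<Sum>(i, c)\<in>J. real p powr - (t * real (m i))) < 1"
    by (rule finite_adic_cover[OF p comp t(1,3)])
  define B where "B = (\<lambda>n. (\<lambda>x. \<lfloor>real p ^ n * x\<rfloor>) ` A)"
  have Bsub: "B n \<subseteq> {0..int p ^ n}" for n
  proof
    fix b assume "b \<in> B n"
    then obtain x where x: "x \<in> A" "b = \<lfloor>real p ^ n * x\<rfloor>" by (auto simp: B_def)
    then have "0 \<le> x" "x \<le> 1" using A01 by auto
    then have "real p ^ n * x \<le> real p ^ n * 1" by (intro mult_left_mono) auto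
    then have "b \<le> int p ^ n" using x by (simp add: floor_le_iff)
    moreover have "0 \<le> b" using x \<open>0 \<le> x\<close> by simp
    ultimately show "b \<in> {0..int p ^ n}" by simp
  qed
  have Bfin: "finite (B n)" for n using Bsub finite_subset by blast
  \<comment> \<open>\<open>M\<close> dominates all scales of the cover, so the recursion is
    available for \<open>n \<ge> M\<close>; below \<open>M\<close> the constant \<open>C\<close>
    dominates the trivial count p^n + 1.\<close>
  define M where "M = (\<Sum>(i, c)\<in>J. m i)"
  define C where "C = real p ^ M + 1"
  have mM: "m i \<le> M" if "(i, c) \<in> J" for i c
    unfolding M_def using member_le_sum[OF that, of "\<lambda>(i, c). m i"] J(1) by auto
  \<comment> \<open>A cover interval of level 0 would have mass 1 by itself. Positive levels make
    the recursion descend strictly.\<close>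
  have m0: "0 < m i" if "(i, c) \<in> J" for i c
  proof (rule ccontr)
    assume "\<not> 0 < m i"
    then have "1 \<le> (\<Sum>(i, c)\<in>J. real p powr - (t * real (m i)))"
      using member_le_sum[OF that, of "\<lambda>(i, c). real p powr - (t * real (m i))"] J(1) p by auto
    then show False using J(3) by simp
  qed
  have sum_s: "(\<Sum>(i, c)\<in>J. real p powr - (s * real (m i))) \<le> 1"
  proof -
    have "(\<Sum>(i, c)\<in>J. real p powr - (s * real (m i))) \<le> (\<Sum>(i, c)\<in>J. real p powr - (t * real (m i)))"
      using t p by (intro sum_mono) (auto intro!: powr_mono mult_right_mono)
    then show ?thesis using J(3) by linarith
  qed
  \<comment> \<open>The digits of \<open>x\<close> behind its cover interval are those of another
    point of \<open>A\<close>; a box of level \<open>n\<close> is therefore a cover interval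
    followed by a box of level \<open>n - m i\<close>.\<close>
  have rec: "card (B n) \<le> (\<Sum>(i, c)\<in>J. card (B (n - m i)))" if n: "M \<le> n" for n
  proof -
    have "B n \<subseteq> (\<Union>(i, c)\<in>J. (\<lambda>b. c * int p ^ (n - m i) + b) ` B (n - m i))"
    proof
      fix b assume "b \<in> B n"
      then obtain x where x: "x \<in> A" "b = \<lfloor>real p ^ n * x\<rfloor>" by (auto simp: B_def)
      obtain i c where ic: "(i, c) \<in> J" "\<lfloor>real p ^ m i * x\<rfloor> = c" using J(2) x(1) by blast
      define y where "y = frac (real p ^ m i * x)"
      have y: "y \<in> A" unfolding y_def by (rule times_p_invariant_power[OF inv x(1)])
      have mn: "m i \<le> n" using mM[OF ic(1)] n by linarith
      have "real p ^ n * x = real p ^ (n - m i) * (real p ^ m i * x)"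
        using mn by (simp add: power_add[symmetric] mult.assoc[symmetric])
      also have "real p ^ m i * x = of_int c + y" by (simp add: y_def frac_def ic)
      finally have "real p ^ n * x = of_int (c * int p ^ (n - m i)) + real p ^ (n - m i) * y"
        by (simp add: algebra_simps)
      then have "b = c * int p ^ (n - m i) + \<lfloor>real p ^ (n - m i) * y\<rfloor>"
        using x(2) by linarith
      then show "b \<in> (\<Union>(i, c)\<in>J. (\<lambda>b. c * int p ^ (n - m i) + b) ` B (n - m i))"
        using ic(1) y by (auto simp: B_def)
    qed
    then have "card (B n) \<le> card (\<Union>(i, c)\<in>J. (\<lambda>b. c * int p ^ (n - m i) + b) ` B (n - m i))"
      by (rule card_mono[rotated]) (use J(1) Bfin in auto)
    also have "\<dots> \<le> (\<Sum>j\<in>J. card (case j of (i, c) \<Rightarrow> (\<lambda>b. c * int p ^ (n - m i) + b) ` B (n - m i)))"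
      by (rule card_UN_le[OF J(1)])
    also have "\<dots> \<le> (\<Sum>(i, c)\<in>J. card (B (n - m i)))"
      by (rule sum_mono) (auto intro: card_image_le[OF Bfin])
    finally show ?thesis .
  qed
  have "real (card (B n)) \<le> C * real p powr (s * real n)" for n
  proof (induction n rule: less_induct)
    case (less n)
    show ?case
    proof (cases "n < M")
      case True
      have "card (B n) \<le> card {0..int p ^ n}" by (rule card_mono[OF _ Bsub]) simp
      then have "card (B n) \<le> Suc (p ^ n)" by (simp add: nat_add_distrib nat_power_eq)
      then have "real (card (B n)) \<le> real (Suc (p ^ n))" by (simp only: of_nat_le_iff)
      then have "real (card (B n)) \<le> real p ^ n + 1" by simp
      also have "\<dots> \<le> C * 1" unfolding C_def using True p by (simp add: power_increasing)
      also have "\<dots> \<le> C * real p powr (s * real n)"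
        unfolding C_def using t p by (intro mult_left_mono ge_one_powr_ge_zero) auto
      finally show ?thesis .
    next
      case False
      then have "real (card (B n)) \<le> real (\<Sum>(i, c)\<in>J. card (B (n - m i)))"
        using rec[of n] by (simp only: of_nat_le_iff not_less)
      also have "\<dots> = (\<Sum>(i, c)\<in>J. real (card (B (n - m i))))" by (simp add: split_def)
      also have "\<dots> \<le> (\<Sum>(i, c)\<in>J. C * real p powr (s * real n) * real p powr - (s * real (m i)))"
      proof (rule sum_mono, clarify)
        fix i c assume ic: "(i, c) \<in> J"
        have "n - m i < n" "m i \<le> n" using m0[OF ic] mM[OF ic] False by auto
        then have "real (card (B (n - m i))) \<le> C * real p powr (s * real (n - m i))" using less by blast
        also have "\<dots> = C * real p powr (s * real n) * real p powr - (s * real (m i))"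
          using \<open>m i \<le> n\<close> by (simp add: powr_add[symmetric] of_nat_diff algebra_simps)
        finally show "real (card (B (n - m i))) \<le> C * real p powr (s * real n) * real p powr - (s * real (m i))" .
      qed
      also have "\<dots> = C * real p powr (s * real n) * (\<Sum>(i, c)\<in>J. real p powr - (s * real (m i)))"
        by (simp add: sum_distrib_left split_def)
      also have "\<dots> \<le> C * real p powr (s * real n) * 1"
        using sum_s by (intro mult_left_mono) (auto simp: C_def)
      finally show ?thesis by simp
    qed
  qed
  moreover have "1 \<le> C" by (simp add: C_def)
  ultimately show ?thesis using that by (auto simp: B_def)
qed

section \<open>The rotation by log 3 2\<close>

definition rotation_cell :: "real \<Rightarrow> nat \<Rightarrow> nat \<Rightarrow> int" where
  "rotation_cell \<alpha> n m = \<lfloor>2 ^ n * frac (real m * \<alpha>)\<rfloor>"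

text \<open>Trades reduction modulo 1 before rounding for reduction modulo 2^n after it, so that
  cells can be added as residues.\<close>

lemma floor_scaled_frac: "\<lfloor>2 ^ n * frac x\<rfloor> = \<lfloor>2 ^ n * (x::real)\<rfloor> mod 2 ^ n"
proof -
  have "2 ^ n * frac x = 2 ^ n * x - of_int (2 ^ n * \<lfloor>x\<rfloor>)"
    by (simp add: frac_def algebra_simps)
  then have eq: "\<lfloor>2 ^ n * frac x\<rfloor> = \<lfloor>2 ^ n * x\<rfloor> - 2 ^ n * \<lfloor>x\<rfloor>" by (simp only: floor_diff_of_int)
  have "2 ^ n * frac x < 2 ^ n * 1" by (intro mult_strict_left_mono frac_lt_1) simp
  then have "\<lfloor>2 ^ n * frac x\<rfloor> < 2 ^ n" by (simp add: floor_less_iff)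
  moreover have "0 \<le> \<lfloor>2 ^ n * frac x\<rfloor>" by (simp add: frac_ge_0)
  ultimately have "\<lfloor>2 ^ n * frac x\<rfloor> mod 2 ^ n = \<lfloor>2 ^ n * frac x\<rfloor>" by (intro mod_pos_pos_trivial) auto
  moreover have "(\<lfloor>2 ^ n * x\<rfloor> - 2 ^ n * \<lfloor>x\<rfloor>) mod 2 ^ n = \<lfloor>2 ^ n * x\<rfloor> mod 2 ^ n"
    by (simp add: mod_diff_right_eq[symmetric])
  ultimately show ?thesis using eq by simp
qed

lemma rotation_cell_range: "rotation_cell \<alpha> n m \<in> {0..<2 ^ n}"
  unfolding rotation_cell_def floor_scaled_frac by simp

text \<open>The alternatives are the absence or presence of a carry when the two floors are
  added.\<close>

lemma rotation_cell_add:
  "rotation_cell \<alpha> n (m + j) = (rotation_cell \<alpha> n m + \<lfloor>2 ^ n * (real j * \<alpha>)\<rfloor>) mod 2 ^ n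
   \<or> rotation_cell \<alpha> n (m + j) = (rotation_cell \<alpha> n m + \<lfloor>2 ^ n * (real j * \<alpha>)\<rfloor> + 1) mod 2 ^ n"
proof -
  let ?x = "2 ^ n * (real m * \<alpha>)" and ?y = "2 ^ n * (real j * \<alpha>)"
  have "2 ^ n * (real (m + j) * \<alpha>) = ?x + ?y" by (simp add: algebra_simps)
  moreover have "\<lfloor>?x + ?y\<rfloor> = \<lfloor>?x\<rfloor> + \<lfloor>?y\<rfloor> \<or> \<lfloor>?x + ?y\<rfloor> = \<lfloor>?x\<rfloor> + \<lfloor>?y\<rfloor> + 1" by linarith
  ultimately show ?thesis
    unfolding rotation_cell_def floor_scaled_frac
    by (metis (no_types, opaque_lifting) add.assoc mod_add_left_eq)
qed

text \<open>Only the carry is unknown, so given the present cell a later one costs at most one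
  bit.\<close>

lemma rotation_cell_shift_card:
  "card ((\<lambda>\<omega>. rotation_cell \<alpha> n (k + \<omega> + j)) ` {\<omega>\<in>E. rotation_cell \<alpha> n (k + \<omega>) = v}) \<le> 2"
proof -
  let ?t = "\<lfloor>2 ^ n * (real j * \<alpha>)\<rfloor>"
  have "(\<lambda>\<omega>. rotation_cell \<alpha> n (k + \<omega> + j)) ` {\<omega>\<in>E. rotation_cell \<alpha> n (k + \<omega>) = v}
     \<subseteq> {(v + ?t) mod 2 ^ n, (v + ?t + 1) mod 2 ^ n}"
    using rotation_cell_add by auto
  then have "card ((\<lambda>\<omega>. rotation_cell \<alpha> n (k + \<omega> + j)) ` {\<omega>\<in>E. rotation_cell \<alpha> n (k + \<omega>) = v})
     \<le> card {(v + ?t) mod 2 ^ n, (v + ?t + 1) mod 2 ^ n}"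
    by (rule card_mono[rotated]) simp
  also have "\<dots> \<le> 2" by (simp add: card_insert_if)
  finally show ?thesis .
qed

lemma mod_add_cancel_range:
  fixes a :: int
  assumes "(a + int i) mod int M = (a + int j) mod int M" "i < M" "j < M"
  shows "i = j"
proof -
  have "int M dvd (a + int i) - (a + int j)" using assms(1) by (simp add: mod_eq_dvd_iff)
  then have "int M dvd int i - int j" by simp
  then show ?thesis using assms(2,3) zdvd_not_zless[of "\<bar>int i - int j\<bar>" "int M"] by force
qed

text \<open>Counting replaces an equidistribution theorem and is uniform in \<open>k\<close> and
  \<open>c\<close>. Waiting times \<open>q j\<close> carry visits of the cell \<open>c\<close> to
  the cell \<open>c + j\<close>, up to a carry. Visit and \<open>j\<close> can be recovered from the
  arrival time and one bit, so 2^n copies of the visit set fit into 2 (N + Q) places, at most 4 N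
  once \<open>Q \<le> N\<close>.\<close>

lemma rotation_cell_frequency:
  fixes \<alpha> :: real
  assumes irr: "\<alpha> \<notin> \<rat>"
  obtains N1 where "\<And>N k c. N1 \<le> N \<Longrightarrow> card {\<omega>\<in>{..<N}. rotation_cell \<alpha> n (k + \<omega>) = c} * 2 ^ n \<le> 4 * N"
proof -
  define M :: nat where "M = 2 ^ n"
  have M: "0 < M" "int M = 2 ^ n" "real M = 2 ^ n" by (simp_all add: M_def)
  have "\<exists>q. rotation_cell \<alpha> n q = int j" if j: "j < M" for j
  proof -
    \<comment> \<open>Kronecker approximation is aimed at the midpoint of the cell with tolerance
      half a cell, which forces the floor to be exactly \<open>j\<close>.\<close>
    have "real (Suc j) \<le> real M" using j by (simp only: of_nat_le_iff Suc_le_eq)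
    then have "real j + 1/2 \<le> real M" by simp
    moreover have "0 < real M" using M by simp
    ultimately have "0 \<le> (real j + 1/2) / real M" "(real j + 1/2) / real M \<le> 1" "0 < 1 / (2 * real M)"
      by (simp_all add: divide_le_eq)
    from Kronecker_approx_1_explicit[OF irr this] obtain q
      where "\<bar>frac (real q * \<alpha>) - (real j + 1/2) / real M\<bar> < 1 / (2 * real M)" .
    then have "real M * \<bar>frac (real q * \<alpha>) - (real j + 1/2) / real M\<bar> < 1 / 2"
      using M by (simp add: field_simps)
    then have "\<bar>real M * (frac (real q * \<alpha>) - (real j + 1/2) / real M)\<bar> < 1 / 2"
      by (simp add: abs_mult)
    then have "\<bar>real M * frac (real q * \<alpha>) - (real j + 1/2)\<bar> < 1 / 2"
      using M by (simp add: right_diff_distrib)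
    then have "\<lfloor>real M * frac (real q * \<alpha>)\<rfloor> = int j" by linarith
    then show ?thesis unfolding rotation_cell_def using M(3) by (intro exI[of _ q]) simp
  qed
  then obtain q where q: "\<And>j. j < M \<Longrightarrow> rotation_cell \<alpha> n (q j) = int j" by metis
  define Q where "Q = (\<Sum>j<M. q j)"
  have Q: "q j \<le> Q" if "j < M" for j
    unfolding Q_def using that by (intro member_le_sum) auto
  show ?thesis
  proof (rule that[of Q])
    fix N k c assume N: "Q \<le> N"
    define V where "V = {\<omega>\<in>{..<N}. rotation_cell \<alpha> n (k + \<omega>) = c}"
    \<comment> \<open>The boolean records whether a carry occurred; with the arrival time it fixes
      \<open>j\<close>, and then the visit.\<close>
    define F where "F = (\<lambda>(\<omega>, j). (\<omega> + q j, rotation_cell \<alpha> n (k + (\<omega> + q j)) = (c + int j) mod int M))"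
    have step: "rotation_cell \<alpha> n (k + (\<omega> + q j)) = (c + int j) mod int M
        \<or> rotation_cell \<alpha> n (k + (\<omega> + q j)) = (c + 1 + int j) mod int M" if "\<omega> \<in> V" "j < M" for \<omega> j
    proof -
      have j: "\<lfloor>2 ^ n * (real (q j) * \<alpha>)\<rfloor> mod 2 ^ n = int j"
        using q[OF that(2)] by (simp add: rotation_cell_def floor_scaled_frac)
      have c: "rotation_cell \<alpha> n (k + \<omega>) = c" using that(1) by (simp add: V_def)
      have 1: "(c + \<lfloor>2 ^ n * (real (q j) * \<alpha>)\<rfloor>) mod 2 ^ n = (c + int j) mod 2 ^ n"
        using j by (metis mod_add_right_eq)
      have "(c + \<lfloor>2 ^ n * (real (q j) * \<alpha>)\<rfloor> + 1) mod 2 ^ n = ((c + 1) + \<lfloor>2 ^ n * (real (q j) * \<alpha>)\<rfloor>) mod 2 ^ n"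
        by (simp add: algebra_simps)
      also have "\<dots> = (c + 1 + int j) mod 2 ^ n"
        using j by (metis mod_add_right_eq)
      finally show ?thesis
        using rotation_cell_add[of \<alpha> n "k + \<omega>" "q j"] 1 unfolding c M(2) by (auto simp: add.assoc)
    qed
    have "inj_on F (V \<times> {..<M})"
    proof (rule inj_onI)
      fix x x' assume x: "x \<in> V \<times> {..<M}" "x' \<in> V \<times> {..<M}" "F x = F x'"
      obtain \<omega> j \<omega>' j' where xx: "x = (\<omega>, j)" "x' = (\<omega>', j')" by (cases x, cases x')
      have v: "\<omega> \<in> V" "\<omega>' \<in> V" and jj: "j < M" "j' < M" and eq: "F (\<omega>, j) = F (\<omega>', j')"
        using x unfolding xx by auto
      have e1: "\<omega> + q j = \<omega>' + q j'"
        using eq unfolding F_def prod.case prod.inject by (rule conjunct1)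
      have e2: "(rotation_cell \<alpha> n (k + (\<omega> + q j)) = (c + int j) mod int M)
             \<longleftrightarrow> (rotation_cell \<alpha> n (k + (\<omega>' + q j')) = (c + int j') mod int M)"
        using eq unfolding F_def prod.case prod.inject by (rule conjunct2)
      have "j = j'"
      proof (cases "rotation_cell \<alpha> n (k + (\<omega> + q j)) = (c + int j) mod int M")
        case True
        then have "(c + int j) mod int M = (c + int j') mod int M" using e1 e2 by metis
        then show ?thesis using mod_add_cancel_range jj by blast
      next
        case False
        then have "(c + 1 + int j) mod int M = (c + 1 + int j') mod int M"
          using e1 e2 step[OF v(1) jj(1)] step[OF v(2) jj(2)] by metis
        then show ?thesis using mod_add_cancel_range jj by blast
      qed
      then show "x = x'" using e1 xx by simp
    qed
    then have "card (V \<times> {..<M}) = card (F ` (V \<times> {..<M}))" by (simp add: card_image)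
    also have "\<dots> \<le> card ({..<N + Q} \<times> (UNIV :: bool set))"
    proof (rule card_mono)
      show "F ` (V \<times> {..<M}) \<subseteq> {..<N + Q} \<times> UNIV"
      proof (clarsimp simp: F_def)
        fix \<omega> j assume "\<omega> \<in> V" "j < M"
        then have "\<omega> < N" "q j \<le> Q" using Q by (auto simp: V_def)
        then show "\<omega> + q j < N + Q" by simp
      qed
    qed simp
    also have "\<dots> \<le> 4 * N" using N by simp
    finally show "card {\<omega>\<in>{..<N}. rotation_cell \<alpha> n (k + \<omega>) = c} * 2 ^ n \<le> 4 * N"
      by (simp add: V_def M_def card_cartesian_product)
  qed
qed

lemma log_3_2_irrational: "log 3 2 \<notin> \<rat>"
proof
  assume "log 3 2 \<in> \<rat>"
  moreover have "0 < log 3 (2::real)" by simp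
  ultimately obtain a b :: nat where ab: "b \<noteq> 0" "log 3 2 = real a / real b"
    using Rats_abs_nat_div_natE[of "log 3 2"] by (metis abs_of_pos)
  have "(2::real) ^ b = (3 powr log 3 2) powr real b" by (simp add: powr_realpow)
  also have "\<dots> = 3 powr real a" using ab by (simp add: powr_powr)
  also have "\<dots> = 3 ^ a" by (simp add: powr_realpow)
  finally have "real (2 ^ b) = real (3 ^ a)" by simp
  then have "(2::nat) ^ b = 3 ^ a" by (simp only: of_nat_eq_iff)
  moreover have "even ((2::nat) ^ b)" "odd ((3::nat) ^ a)" using ab by auto
  ultimately show False by metis
qed

section \<open>Synchronising powers of 3 with powers of 2\<close>

definition ternary_level :: "nat \<Rightarrow> nat" where
  "ternary_level m = nat \<lfloor>real m * log 3 2\<rfloor>"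

lemma log_3_2_bounds: "0 < log 3 (2::real)" "log 3 (2::real) < 1"
  by simp_all

lemma ternary_level_real: "real (ternary_level m) = of_int \<lfloor>real m * log 3 2\<rfloor>"
  by (simp add: ternary_level_def)

text \<open>This links slopes to the rotation: removing the integer part of the base-3 logarithm of
  2^m divides by the largest power of 3 not exceeding 2^m, and the fractional part left over is the
  angle.\<close>

lemma ratio_eq_powr_frac: "2 ^ m / 3 ^ ternary_level m = 3 powr frac (real m * log 3 2)"
proof -
  have "3 powr (real m * log 3 2) = (3 powr log 3 2) powr real m" by (simp only: powr_powr mult.commute)
  also have "\<dots> = (2::real) ^ m" by (simp add: powr_realpow)
  finally show ?thesis
    unfolding frac_def powr_diff by (simp add: ternary_level_real[symmetric] powr_realpow)
qed

lemma ternary_level_bounds: "3 ^ ternary_level m \<le> (2::real) ^ m" "(2::real) ^ m < 3 * 3 ^ ternary_level m"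
proof -
  have "(3::real) powr 0 \<le> 3 powr frac (real m * log 3 2)"
    by (rule powr_mono) (simp_all add: frac_ge_0)
  moreover have "(3::real) powr frac (real m * log 3 2) < 3 powr 1"
    by (rule powr_less_mono) (simp_all add: frac_lt_1)
  ultimately
  have "1 \<le> (2::real) ^ m / 3 ^ ternary_level m" "(2::real) ^ m / 3 ^ ternary_level m < 3"
    unfolding ratio_eq_powr_frac by simp_all
  then show "3 ^ ternary_level m \<le> (2::real) ^ m" "(2::real) ^ m < 3 * 3 ^ ternary_level m"
    by (simp_all add: field_simps)
qed

lemma ternary_level_Suc: "ternary_level (Suc m) = ternary_level m \<or> ternary_level (Suc m) = Suc (ternary_level m)"
proof -
  have "real (Suc m) * log 3 2 = real m * log 3 2 + log 3 2" by (simp add: algebra_simps)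
  moreover have "0 \<le> real m * log 3 2" by simp
  ultimately show ?thesis using log_3_2_bounds unfolding ternary_level_def by linarith
qed

text \<open>On nonnegative reals \<open>3 powr x\<close> does not shrink distances, since
  \<open>ln 3 \<ge> 1\<close>; close slopes thus have close angles. The extra 1 accounts for
  rounding.\<close>

lemma rotation_cell_ratio_close:
  assumes "\<bar>2 ^ m / 3 ^ ternary_level m - 2 ^ m' / 3 ^ ternary_level m'\<bar> \<le> \<delta> / 2 ^ n"
  shows "real_of_int \<bar>rotation_cell (log 3 2) n m - rotation_cell (log 3 2) n m'\<bar> \<le> \<delta> + 1"
proof -
  have *: "x - y \<le> 3 powr x - 3 powr y" if "0 \<le> y" "y \<le> x" for x y :: real
  proof -
    have "ln (3 powr (x - y)) \<le> 3 powr (x - y) - 1" by (rule ln_le_minus_one) simp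
    moreover have "1 \<le> ln (3::real)" using exp_le ln_ge_iff[of 3 1] by simp
    then have "(x - y) * 1 \<le> (x - y) * ln 3" using that by (intro mult_left_mono) auto
    ultimately have "x - y \<le> 3 powr (x - y) - 1" by (simp add: ln_powr)
    also have "\<dots> \<le> 3 powr y * (3 powr (x - y) - 1)"
      using that ge_one_powr_ge_zero[of 3 y] ge_one_powr_ge_zero[of 3 "x - y"] by (intro mult_le_cancel_right1[THEN iffD2]) auto
    also have "\<dots> = 3 powr x - 3 powr y" by (simp add: right_diff_distrib powr_add[symmetric])
    finally show ?thesis .
  qed
  let ?x = "frac (real m * log 3 2)" and ?y = "frac (real m' * log 3 2)"
  have "\<bar>?x - ?y\<bar> \<le> \<bar>3 powr ?x - 3 powr ?y\<bar>"
    using *[of ?x ?y] *[of ?y ?x] frac_ge_0[of "real m * log 3 2"] frac_ge_0[of "real m' * log 3 2"]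
    by linarith
  also have "\<dots> \<le> \<delta> / 2 ^ n" using assms by (simp add: ratio_eq_powr_frac)
  finally have "2 ^ n * \<bar>?x - ?y\<bar> \<le> \<delta>" by (simp add: field_simps)
  then have "\<bar>2 ^ n * ?x - 2 ^ n * ?y\<bar> \<le> \<delta>" by (simp add: right_diff_distrib[symmetric] abs_mult)
  then show ?thesis unfolding rotation_cell_def by linarith
qed

section \<open>Slopes seen from a point of the slice\<close>

text \<open>The \<open>m\<close>-th symbol lists how many base-\<open>p\<close> digits are consumed between times \<open>m\<close> and
  \<open>Suc m\<close>, and these digits. For the ternary coding \<open>Q\<close> is \<open>ternary_level\<close>, which
  synchronises \<open>3\<^sup>Q\<close> with \<open>2\<^sup>m\<close>.\<close>
definition adic_symbol :: "nat \<Rightarrow> (nat \<Rightarrow> nat) \<Rightarrow> real \<Rightarrow> nat \<Rightarrow> nat \<times> int" where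
  "adic_symbol p Q x m = (Q (Suc m) - Q m, \<lfloor>real p ^ (Q (Suc m) - Q m) * frac (real p ^ Q m * x)\<rfloor>)"

text \<open>Induction peels off the first symbol: equal digits cancel, so passing to the next time
  multiplies the difference exactly by a power of \<open>p\<close>. The digit count inside the
  symbol keeps the two orbits synchronised.\<close>

lemma adic_symbol_eq_imp_close:
  assumes p: "0 < p" and mono: "\<And>m. Q m \<le> Q (Suc m)"
    and eq: "\<And>i. i < n \<Longrightarrow> adic_symbol p Q x (m + i) = adic_symbol p Q x (m' + i)"
  shows "Q (m + n) - Q m = Q (m' + n) - Q m' \<and>
    \<bar>frac (real p ^ Q m * x) - frac (real p ^ Q m' * x)\<bar> \<le> 1 / real p ^ (Q (m + n) - Q m)"
  using eq
proof (induction n arbitrary: m m')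
  case 0
  have "\<bar>frac (real p ^ Q m * x) - frac (real p ^ Q m' * x)\<bar> < 1"
    using frac_ge_0[of "real p ^ Q m * x"] frac_lt_1[of "real p ^ Q m * x"]
      frac_ge_0[of "real p ^ Q m' * x"] frac_lt_1[of "real p ^ Q m' * x"] by linarith
  then show ?case by simp
next
  case (Suc n)
  have "adic_symbol p Q x (Suc m + i) = adic_symbol p Q x (Suc m' + i)" if "i < n" for i
    using Suc.prems[of "Suc i"] that by simp
  from Suc.IH[OF this] have IH: "Q (Suc m + n) - Q (Suc m) = Q (Suc m' + n) - Q (Suc m')"
    "\<bar>frac (real p ^ Q (Suc m) * x) - frac (real p ^ Q (Suc m') * x)\<bar> \<le> 1 / real p ^ (Q (Suc m + n) - Q (Suc m))"
    by auto
  define d where "d = Q (Suc m) - Q m"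
  have d: "Q (Suc m) = Q m + d" "Q (Suc m') = Q m' + d"
    and fl: "\<lfloor>real p ^ d * frac (real p ^ Q m * x)\<rfloor> = \<lfloor>real p ^ d * frac (real p ^ Q m' * x)\<rfloor>"
    using Suc.prems[of 0] mono[of m] mono[of m'] by (auto simp: d_def adic_symbol_def)
  have Qle: "Q i \<le> Q (i + j)" for i j
    by (induction j) (auto intro: order_trans mono)
  have shift: "frac (real p ^ (r + d) * x) = real p ^ d * frac (real p ^ r * x) - of_int \<lfloor>real p ^ d * frac (real p ^ r * x)\<rfloor>" for r
  proof -
    have "frac (real p ^ (r + d) * x) = frac (real (p ^ d) * (real p ^ r * x))"
      by (simp add: power_add mult_ac)
    also have "\<dots> = frac (real (p ^ d) * frac (real p ^ r * x))"
      by (rule frac_of_nat_mult_frac[symmetric])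
    finally show ?thesis by (simp add: frac_def)
  qed
  have "real p ^ d * \<bar>frac (real p ^ Q m * x) - frac (real p ^ Q m' * x)\<bar>
      = \<bar>real p ^ d * frac (real p ^ Q m * x) - real p ^ d * frac (real p ^ Q m' * x)\<bar>"
    by (simp add: right_diff_distrib[symmetric] abs_mult)
  also have "\<dots> = \<bar>frac (real p ^ Q (Suc m) * x) - frac (real p ^ Q (Suc m') * x)\<bar>"
    unfolding d shift fl by simp
  also have "\<dots> \<le> 1 / real p ^ (Q (Suc m + n) - Q (Suc m))" by (rule IH(2))
  finally have "\<bar>frac (real p ^ Q m * x) - frac (real p ^ Q m' * x)\<bar> \<le> 1 / (real p ^ d * real p ^ (Q (Suc m + n) - Q (Suc m)))"
    using p by (simp add: field_simps)
  also have "real p ^ d * real p ^ (Q (Suc m + n) - Q (Suc m)) = real p ^ (Q (m + Suc n) - Q m)"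
    using d Qle[of "Suc m" n] by (simp add: power_add[symmetric])
  finally have "\<bar>frac (real p ^ Q m * x) - frac (real p ^ Q m' * x)\<bar> \<le> 1 / real p ^ (Q (m + Suc n) - Q m)" .
  moreover have "Q (m + Suc n) - Q m = Q (m' + Suc n) - Q m'"
    using d Qle[of "Suc m" n] Qle[of "Suc m'" n] IH(1) by simp
  ultimately show ?case by blast
qed

lemma adic_symbol_range:
  assumes p: "0 < p" and step: "Q (Suc m) = Q m \<or> Q (Suc m) = Suc (Q m)"
  shows "adic_symbol p Q x m \<in> {0, 1} \<times> {0..<int p}"
proof -
  define d where "d = Q (Suc m) - Q m"
  have d: "d = 0 \<or> d = 1" using step by (auto simp: d_def)
  let ?y = "frac (real p ^ Q m * x)"
  have "real p ^ d \<le> real p" using d p by auto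
  then have "real p ^ d * ?y \<le> real p * ?y" by (intro mult_right_mono) (auto simp: frac_ge_0)
  also have "\<dots> < real p * 1" using p by (intro mult_strict_left_mono) (auto simp: frac_lt_1)
  finally have "\<lfloor>real p ^ d * ?y\<rfloor> < int p" by (simp add: floor_less_iff)
  moreover have "0 \<le> \<lfloor>real p ^ d * ?y\<rfloor>" by (simp add: frac_ge_0)
  ultimately show ?thesis using d unfolding adic_symbol_def d_def by auto
qed

section \<open>Counting the slopes compatible with a digit block\<close>

lemma card_image_le_fibres:
  assumes fin: "finite T" and fib: "\<And>v. card (g ` {m\<in>T. f m = v}) \<le> d"
  shows "card (g ` T) \<le> card (f ` T) * d"
proof -
  have "g ` T = (\<Union>v\<in>f ` T. g ` {m\<in>T. f m = v})" by auto
  then have "card (g ` T) \<le> (\<Sum>v\<in>f ` T. card (g ` {m\<in>T. f m = v}))"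
    using card_UN_le[of "f ` T" "\<lambda>v. g ` {m\<in>T. f m = v}"] fin by simp
  also have "\<dots> \<le> (\<Sum>v\<in>f ` T. d)" by (intro sum_mono fib)
  finally show ?thesis by simp
qed

text \<open>Rests on u (r - r') Y = (D - D') + u r' (Y' - Y): the right side is at most (2 +
  18/\<gamma>) \<eta>, while |u| |Y| is at least \<gamma>^2/6.\<close>

lemma slope_close:
  fixes u r r' D D' Y Y' \<gamma> \<eta> :: real
  assumes D: "D = u * r * Y" "D' = u * r' * Y'" and g: "0 < \<gamma>" "\<gamma> < \<bar>u\<bar>"
    and Y: "\<gamma> / 6 \<le> \<bar>Y\<bar>" and ur: "\<bar>u * r'\<bar> \<le> 3 / \<gamma>"
    and DD: "\<bar>D - D'\<bar> \<le> 2 * \<eta>" and YY: "\<bar>Y - Y'\<bar> \<le> 6 * \<eta>"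
  shows "\<bar>r - r'\<bar> \<le> (12 / \<gamma>\<^sup>2 + 108 / \<gamma> ^ 3) * \<eta>"
proof -
  have "u * (r - r') * Y = (D - D') + u * r' * (Y' - Y)" by (simp add: D algebra_simps)
  then have "\<bar>u\<bar> * \<bar>r - r'\<bar> * \<bar>Y\<bar> = \<bar>(D - D') + u * r' * (Y' - Y)\<bar>" by (simp add: abs_mult[symmetric])
  also have "\<dots> \<le> \<bar>D - D'\<bar> + \<bar>u * r'\<bar> * \<bar>Y' - Y\<bar>"
    by (rule order_trans[OF abs_triangle_ineq]) (simp add: abs_mult)
  also have "\<dots> \<le> 2 * \<eta> + 3 / \<gamma> * (6 * \<eta>)"
    using DD ur YY g by (intro add_mono mult_mono) (auto simp: abs_minus_commute)
  finally have 1: "\<bar>u\<bar> * \<bar>r - r'\<bar> * \<bar>Y\<bar> \<le> 2 * \<eta> + 3 / \<gamma> * (6 * \<eta>)" .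
  have "\<gamma> * \<bar>r - r'\<bar> * (\<gamma> / 6) \<le> \<bar>u\<bar> * \<bar>r - r'\<bar> * \<bar>Y\<bar>"
    using g Y by (intro mult_mono) auto
  then have "\<gamma> * \<bar>r - r'\<bar> * (\<gamma> / 6) \<le> 2 * \<eta> + 3 / \<gamma> * (6 * \<eta>)" using 1 by linarith
  then have "\<bar>r - r'\<bar> \<le> (2 * \<eta> + 3 / \<gamma> * (6 * \<eta>)) * (6 / \<gamma>\<^sup>2)"
    using g by (simp add: field_simps power2_eq_square)
  also have "\<dots> = (12 / \<gamma>\<^sup>2 + 108 / \<gamma> ^ 3) * \<eta>"
    using g by (simp add: field_simps power2_eq_square power3_eq_cube)
  finally show ?thesis .
qed

text \<open>A point of the slice at distance about \<open>2\<^sup>-\<^sup>m\<close> from \<open>a\<close> exhibits the slope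
  \<open>u 2\<^sup>m / 3\<^sup>q\<close> of the rescaled line as a quotient of differences of points of \<open>A2\<close> and \<open>A3\<close>;
  the integers \<open>i\<close> and \<open>j\<close> undo the reductions modulo 1.\<close>
lemma sparse_index_slope:
  assumes inv2: "times_p_invariant 2 A2" and inv3: "times_p_invariant 3 A3"
    and g: "0 < \<gamma>" "\<gamma> < \<bar>u\<bar>" "\<bar>u\<bar> < 1 / \<gamma>" and a: "a = u * a' + v"
    and m: "m \<in> sparse_index_at (slice A2 A3 u v) a"
  obtains x y :: real and i j :: int where "x \<in> A2" "y \<in> A3" "\<bar>i\<bar> \<le> 1" "\<bar>j\<bar> \<le> \<lceil>1 / \<gamma>\<rceil> + 1"
    "x - frac (2 ^ m * a) + of_int i
      = u * (2 ^ m / 3 ^ ternary_level m) * (y - frac (3 ^ ternary_level m * a') + of_int j)"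
    "\<gamma> / 6 \<le> \<bar>y - frac (3 ^ ternary_level m * a') + of_int j\<bar>"
    "\<bar>u * (2 ^ m / 3 ^ ternary_level m)\<bar> \<le> 3 / \<gamma>"
proof -
  obtain b where b: "b \<in> slice A2 A3 u v" and
    bm: "b - a \<in> {(1/2) ^ (m+1) .. (1/2) ^ m} \<union> {- ((1/2) ^ m) .. - ((1/2) ^ (m+1))}"
    using m unfolding sparse_index_at_def sparse_index_def by blast
  have dist: "(1/2) ^ (m+1) \<le> \<bar>b - a\<bar>" "\<bar>b - a\<bar> \<le> (1/2) ^ m"
    using bm zero_le_power[of "1/2::real" m] zero_le_power[of "1/2::real" "m+1"] by (auto simp: abs_if)
  obtain b' where b': "b \<in> A2" "b' \<in> A3" "b = u * b' + v" using b by (auto simp: slice_def)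
  define q where "q = ternary_level m"
  define r :: real where "r = 2 ^ m / 3 ^ q"
  define D where "D = 2 ^ m * (b - a)"
  define Y where "Y = 3 ^ q * (b' - a')"
  have DY: "D = u * r * Y" by (simp add: D_def Y_def r_def a b'(3) field_simps)
  have r: "1 \<le> r" "r < 3" using ternary_level_bounds[of m] by (simp_all add: r_def q_def field_simps)
  have "\<bar>D\<bar> = 2 ^ m * \<bar>b - a\<bar>" by (simp add: D_def abs_mult)
  moreover have "2 ^ m * (1/2) ^ (m+1) \<le> 2 ^ m * \<bar>b - a\<bar>" "2 ^ m * \<bar>b - a\<bar> \<le> 2 ^ m * (1/2) ^ m"
    by (intro mult_left_mono dist; simp)+
  \<comment> \<open>The lower bound is what membership in the sparse index provides; it keeps
    \<open>Y\<close> away from 0, so that the slope depends stably on the two points.\<close>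
  ultimately have Dm: "1/2 \<le> \<bar>D\<bar>" "\<bar>D\<bar> \<le> 1"
    by (simp_all add: power_one_over)
  have u0: "0 < \<bar>u\<bar>" using g by linarith
  have ur: "\<bar>u * r\<bar> \<le> 3 / \<gamma>"
  proof -
    have "\<bar>u\<bar> * \<bar>r\<bar> \<le> 1 / \<gamma> * 3" using g r by (intro mult_mono) auto
    then show ?thesis by (simp add: abs_mult)
  qed
  have urY: "\<bar>D\<bar> = \<bar>u * r\<bar> * \<bar>Y\<bar>" by (simp add: DY abs_mult)
  have "1/2 \<le> 3 / \<gamma> * \<bar>Y\<bar>"
    using Dm(1) mult_right_mono[OF ur, of "\<bar>Y\<bar>"] urY by linarith
  then have Yl: "\<gamma> / 6 \<le> \<bar>Y\<bar>" using g by (simp add: field_simps)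
  have "\<gamma> * 1 \<le> \<bar>u\<bar> * \<bar>r\<bar>" using g r by (intro mult_mono) auto
  then have "\<gamma> * \<bar>Y\<bar> \<le> \<bar>u * r\<bar> * \<bar>Y\<bar>" by (intro mult_right_mono) (auto simp: abs_mult)
  then have Yu: "\<bar>Y\<bar> \<le> 1 / \<gamma>" using Dm(2) urY g by (simp add: field_simps)
  define x where "x = frac (2 ^ m * b)"
  define y where "y = frac (3 ^ q * b')"
  define i where "i = \<lfloor>2 ^ m * b\<rfloor> - \<lfloor>2 ^ m * a\<rfloor>"
  define j where "j = \<lfloor>3 ^ q * b'\<rfloor> - \<lfloor>3 ^ q * a'\<rfloor>"
  have xi: "x - frac (2 ^ m * a) + of_int i = D"
    by (simp add: x_def i_def D_def frac_def algebra_simps)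
  have yj: "y - frac (3 ^ q * a') + of_int j = Y"
    by (simp add: y_def j_def Y_def frac_def algebra_simps)
  have x: "x \<in> A2" using times_p_invariant_power[OF inv2 b'(1), of m] by (simp add: x_def)
  have y: "y \<in> A3" using times_p_invariant_power[OF inv3 b'(2), of q] by (simp add: y_def)
  have "\<bar>i\<bar> \<le> 1"
    using Dm(2) unfolding i_def D_def right_diff_distrib by linarith
  moreover have "\<bar>j\<bar> \<le> \<lceil>1 / \<gamma>\<rceil> + 1"
    using Yu unfolding j_def Y_def right_diff_distrib by linarith
  ultimately show ?thesis
    using that[OF x y, of i j] xi yj DY Yl ur by (simp add: q_def r_def)
qed

lemma floor_eq_imp_close:
  fixes x y :: real
  assumes "\<lfloor>c * x\<rfloor> = \<lfloor>c * y\<rfloor>" "0 < c"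
  shows "\<bar>x - y\<bar> \<le> 1 / c"
proof -
  have "\<bar>c * x - c * y\<bar> \<le> 1" using assms(1) by linarith
  then have "c * \<bar>x - y\<bar> \<le> 1" using assms(2) by (simp add: right_diff_distrib[symmetric] abs_mult)
  then show ?thesis using assms(2) by (simp add: field_simps)
qed

text \<open>\<open>T\<close> stands for times sharing a digit block. Each time gets a second point
  from \<open>sparse_index_slope\<close>; if two times agree in the boxes of size about 2^-n and in
  the integer corrections of their second points, their slopes differ by O(2^-n). So each such key
  allows boundedly many cells, and box counts bound the number of keys.\<close>

lemma slope_cells_card:
  assumes inv2: "times_p_invariant 2 A2" and inv3: "times_p_invariant 3 A3"
    and s2: "hausdorff_dim A2 < s2" and s3: "hausdorff_dim A3 < s3" and g: "0 < \<gamma>"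
  obtains C where "1 \<le> C"
    "\<And>u v a a' n T. \<gamma> < \<bar>u\<bar> \<Longrightarrow> \<bar>u\<bar> < 1 / \<gamma> \<Longrightarrow> a = u * a' + v \<Longrightarrow> finite T \<Longrightarrow>
       T \<subseteq> sparse_index_at (slice A2 A3 u v) a \<Longrightarrow>
       (\<And>m m'. m \<in> T \<Longrightarrow> m' \<in> T \<Longrightarrow> \<bar>frac (2 ^ m * a) - frac (2 ^ m' * a)\<bar> \<le> 1 / 2 ^ n) \<Longrightarrow>
       (\<And>m m'. m \<in> T \<Longrightarrow> m' \<in> T \<Longrightarrow>
          \<bar>frac (3 ^ ternary_level m * a') - frac (3 ^ ternary_level m' * a')\<bar> \<le> 3 / 2 ^ n) \<Longrightarrow>
       real (card (rotation_cell (log 3 2) n ` T)) \<le> C * 2 powr ((s2 + s3) * real n)"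
proof -
  obtain C2 where C2: "1 \<le> C2" "\<And>n. real (card ((\<lambda>x. \<lfloor>real 2 ^ n * x\<rfloor>) ` A2)) \<le> C2 * real 2 powr (s2 * real n)"
    by (rule box_count_bound[OF _ inv2 s2]) simp_all
  obtain C3 where C3: "1 \<le> C3" "\<And>n. real (card ((\<lambda>x. \<lfloor>real 3 ^ n * x\<rfloor>) ` A3)) \<le> C3 * real 3 powr (s3 * real n)"
    by (rule box_count_bound[OF _ inv3 s3]) simp_all
  have s3pos: "0 < s3"
    using hausdorff_dim_less_imp_null[OF _ s3] inv3 by (metis order_less_trans times_p_invariant_def)
  define J where "J = \<lceil>1 / \<gamma>\<rceil> + 1"
  have "0 < 1 / \<gamma>" using g by simp
  then have J: "0 \<le> J" unfolding J_def by linarith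
  define \<delta> where "\<delta> = 12 / \<gamma>\<^sup>2 + 108 / \<gamma> ^ 3"
  have \<delta>: "0 \<le> \<delta>" using g by (simp add: \<delta>_def)
  define d where "d = nat \<lceil>\<delta>\<rceil> + 1"
  \<comment> \<open>Box counts of \<open>A2\<close> and \<open>A3\<close>, three values of
    \<open>i\<close>, \<open>2 * J + 1\<close> values of \<open>j\<close>, and \<open>Suc d\<close>
    cells per key.\<close>
  define C where "C = C2 * C3 * 3 * real_of_int (2 * J + 1) * real (Suc d)"
  have "1 * 1 * 1 * 1 * 1 \<le> C" unfolding C_def
    using C2(1) C3(1) J by (intro mult_mono) auto
  then have C1: "1 \<le> C" by simp
  show ?thesis
  proof (rule that[OF C1])
    fix u v a a' :: real and n :: nat and T
    assume u: "\<gamma> < \<bar>u\<bar>" "\<bar>u\<bar> < 1 / \<gamma>" and a: "a = u * a' + v" and fin: "finite T"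
      and T: "T \<subseteq> sparse_index_at (slice A2 A3 u v) a"
      and close2: "\<And>m m'. m \<in> T \<Longrightarrow> m' \<in> T \<Longrightarrow> \<bar>frac (2 ^ m * a) - frac (2 ^ m' * a)\<bar> \<le> 1 / 2 ^ n"
      and close3: "\<And>m m'. m \<in> T \<Longrightarrow> m' \<in> T \<Longrightarrow>
          \<bar>frac (3 ^ ternary_level m * a') - frac (3 ^ ternary_level m' * a')\<bar> \<le> 3 / 2 ^ n"
    define r where "r = (\<lambda>m. (2::real) ^ m / 3 ^ ternary_level m)"
    define X where "X = (\<lambda>m. frac (2 ^ m * a))"
    define Z where "Z = (\<lambda>m. frac (3 ^ ternary_level m * a'))"
    define good where "good = (\<lambda>m (x, y, i, j). x \<in> A2 \<and> y \<in> A3 \<and> \<bar>i\<bar> \<le> 1 \<and> \<bar>j\<bar> \<le> J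
        \<and> x - X m + of_int i = u * r m * (y - Z m + of_int j)
        \<and> \<gamma> / 6 \<le> \<bar>y - Z m + of_int j\<bar> \<and> \<bar>u * r m\<bar> \<le> 3 / \<gamma>)"
    have "\<exists>w. good m w" if "m \<in> T" for m
    proof -
      have "m \<in> sparse_index_at (slice A2 A3 u v) a" using that T by blast
      from sparse_index_slope[OF inv2 inv3 g u a this] obtain x y i j where
        "x \<in> A2" "y \<in> A3" "\<bar>i\<bar> \<le> 1" "\<bar>j\<bar> \<le> J" "x - X m + of_int i = u * r m * (y - Z m + of_int j)"
        "\<gamma> / 6 \<le> \<bar>y - Z m + of_int j\<bar>" "\<bar>u * r m\<bar> \<le> 3 / \<gamma>"
        unfolding J_def X_def Z_def r_def by metis
      then have "good m (x, y, i, j)" by (simp add: good_def)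
      then show ?thesis by blast
    qed
    then obtain w where w: "\<And>m. m \<in> T \<Longrightarrow> good m (w m)" by metis
    \<comment> \<open>The level \<open>ternary_level n\<close> gives boxes for \<open>A3\<close> of
      length between 2^-n and 3 * 2^-n.\<close>
    define key where "key = (\<lambda>(x::real, y::real, i::int, j::int).
        (\<lfloor>2 ^ n * x\<rfloor>, \<lfloor>3 ^ ternary_level n * y\<rfloor>, i, j))"
    have cells: "\<bar>rotation_cell (log 3 2) n m - rotation_cell (log 3 2) n m'\<bar> \<le> int d"
      if m: "m \<in> T" "m' \<in> T" and eq: "key (w m) = key (w m')" for m m'
    proof -
      obtain x y i j x' y' where ww: "w m = (x, y, i, j)" "w m' = (x', y', i, j)"
        and fl: "\<lfloor>2 ^ n * x\<rfloor> = \<lfloor>2 ^ n * x'\<rfloor>" "\<lfloor>3 ^ ternary_level n * y\<rfloor> = \<lfloor>3 ^ ternary_level n * y'\<rfloor>"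
        using eq by (cases "w m", cases "w m'") (auto simp: key_def)
      have x: "\<bar>x - x'\<bar> \<le> 1 / 2 ^ n" using floor_eq_imp_close[OF fl(1)] by simp
      have "\<bar>y - y'\<bar> \<le> 1 / 3 ^ ternary_level n" using floor_eq_imp_close[OF fl(2)] by simp
      also have "\<dots> \<le> 3 / 2 ^ n" using ternary_level_bounds(2)[of n] by (simp add: field_simps)
      finally have y: "\<bar>y - y'\<bar> \<le> 3 / 2 ^ n" .
      have "\<bar>r m - r m'\<bar> \<le> \<delta> * (1 / 2 ^ n)" unfolding \<delta>_def
      proof (rule slope_close[OF _ _ g u(1)])
        show "x - X m + of_int i = u * r m * (y - Z m + of_int j)"
          "\<gamma> / 6 \<le> \<bar>y - Z m + of_int j\<bar>"
          using w[OF m(1)] by (simp_all add: good_def ww)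
        show "x' - X m' + of_int i = u * r m' * (y' - Z m' + of_int j)" "\<bar>u * r m'\<bar> \<le> 3 / \<gamma>"
          using w[OF m(2)] by (simp_all add: good_def ww)
        have "\<bar>X m - X m'\<bar> \<le> 1 / 2 ^ n" unfolding X_def by (rule close2[OF m])
        then show "\<bar>(x - X m + of_int i) - (x' - X m' + of_int i)\<bar> \<le> 2 * (1 / 2 ^ n)" using x by linarith
        have "\<bar>Z m - Z m'\<bar> \<le> 3 / 2 ^ n" unfolding Z_def by (rule close3[OF m])
        then show "\<bar>(y - Z m + of_int j) - (y' - Z m' + of_int j)\<bar> \<le> 6 * (1 / 2 ^ n)" using y by linarith
      qed
      then have "real_of_int \<bar>rotation_cell (log 3 2) n m - rotation_cell (log 3 2) n m'\<bar> \<le> \<delta> + 1"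
        by (intro rotation_cell_ratio_close) (simp add: r_def)
      moreover have "\<delta> \<le> real_of_int \<lceil>\<delta>\<rceil>" "0 \<le> \<lceil>\<delta>\<rceil>" using \<delta> by (linarith, simp)
      ultimately show ?thesis unfolding d_def by linarith
    qed
    have "card (rotation_cell (log 3 2) n ` {m\<in>T. key (w m) = k}) \<le> Suc d" for k
      using card_int_close[of "rotation_cell (log 3 2) n ` {m\<in>T. key (w m) = k}" d] cells by blast
    from card_image_le_fibres[OF fin this]
    have le: "card (rotation_cell (log 3 2) n ` T) \<le> card ((\<lambda>m. key (w m)) ` T) * Suc d" .
    let ?B2 = "(\<lambda>x. \<lfloor>real 2 ^ n * x\<rfloor>) ` A2"
    let ?B3 = "(\<lambda>x. \<lfloor>real 3 ^ ternary_level n * x\<rfloor>) ` A3"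
    have fB: "finite ((\<lambda>x. \<lfloor>real p ^ l * x\<rfloor>) ` A)" if "times_p_invariant p A" for p l A
    proof (rule finite_subset)
      show "(\<lambda>x. \<lfloor>real p ^ l * x\<rfloor>) ` A \<subseteq> {0..\<lfloor>real p ^ l\<rfloor>}"
      proof
        fix z assume "z \<in> (\<lambda>x. \<lfloor>real p ^ l * x\<rfloor>) ` A"
        then obtain x where x: "x \<in> A" "z = \<lfloor>real p ^ l * x\<rfloor>" by auto
        then have "0 \<le> x" "x \<le> 1" using that by (auto simp: times_p_invariant_def)
        then have "real p ^ l * x \<le> real p ^ l * 1" by (intro mult_left_mono) auto
        moreover have "0 \<le> real p ^ l * x" using \<open>0 \<le> x\<close> by simp
        ultimately show "z \<in> {0..\<lfloor>real p ^ l\<rfloor>}" using x by (auto intro: floor_mono)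
      qed
    qed simp
    have sub: "(\<lambda>m. key (w m)) ` T \<subseteq> ?B2 \<times> ?B3 \<times> {-1..1} \<times> {-J..J}"
    proof
      fix z assume "z \<in> (\<lambda>m. key (w m)) ` T"
      then obtain m where m: "m \<in> T" "z = key (w m)" by auto
      obtain x y i j where ww: "w m = (x, y, i, j)" by (cases "w m")
      then have "x \<in> A2" "y \<in> A3" "\<bar>i\<bar> \<le> 1" "\<bar>j\<bar> \<le> J" using w[OF m(1)] by (auto simp: good_def)
      then show "z \<in> ?B2 \<times> ?B3 \<times> {-1..1} \<times> {-J..J}"
        unfolding m(2) ww key_def by (auto simp: abs_le_iff)
    qed
    have "card ((\<lambda>m. key (w m)) ` T) \<le> card (?B2 \<times> ?B3 \<times> {-1..1::int} \<times> {-J..J})"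
      by (rule card_mono[OF _ sub]) (intro finite_cartesian_product fB inv2 inv3 finite_atLeastAtMost_int)
    also have "\<dots> = card ?B2 * card ?B3 * 3 * nat (2 * J + 1)"
      using J by (simp add: card_cartesian_product algebra_simps)
    finally have "real (card ((\<lambda>m. key (w m)) ` T)) \<le> real (card ?B2 * card ?B3 * 3 * nat (2 * J + 1))"
      by (simp only: of_nat_le_iff)
    also have "\<dots> = real (card ?B2) * real (card ?B3) * 3 * real_of_int (2 * J + 1)"
      using J by (simp only: of_nat_mult of_nat_numeral of_nat_nat)
    also have "\<dots> \<le> (C2 * 2 powr (s2 * real n)) * (C3 * 2 powr (s3 * real n)) * 3 * real_of_int (2 * J + 1)"
    proof (intro mult_right_mono mult_mono)
      show "real (card ?B2) \<le> C2 * 2 powr (s2 * real n)" using C2(2)[of n] by simp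
      have "(3::real) powr (s3 * real (ternary_level n)) = (3 ^ ternary_level n) powr s3"
        by (simp add: powr_realpow[symmetric] powr_powr mult.commute)
      also have "\<dots> \<le> (2 ^ n) powr s3" using s3pos ternary_level_bounds(1)[of n] by (intro powr_mono2) auto
      also have "\<dots> = 2 powr (s3 * real n)"
        by (simp add: powr_realpow[symmetric] powr_powr mult.commute)
      finally have "C3 * 3 powr (s3 * real (ternary_level n)) \<le> C3 * 2 powr (s3 * real n)"
        using C3(1) by (intro mult_left_mono) auto
      then show "real (card ?B3) \<le> C3 * 2 powr (s3 * real n)" using C3(2)[of "ternary_level n"] by simp
    qed (use C2(1) J in auto)
    also have "\<dots> = C2 * C3 * 3 * real_of_int (2 * J + 1) * 2 powr ((s2 + s3) * real n)"
    proof -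
      have "2 powr ((s2 + s3) * real n) = 2 powr (s2 * real n) * 2 powr (s3 * real n)"
        by (simp add: powr_add distrib_right)
      then show ?thesis by (simp only: mult_ac)
    qed
    finally have key_le: "real (card ((\<lambda>m. key (w m)) ` T)) \<le> C2 * C3 * 3 * real_of_int (2 * J + 1) * 2 powr ((s2 + s3) * real n)" .
    have "real (card (rotation_cell (log 3 2) n ` T)) \<le> real (card ((\<lambda>m. key (w m)) ` T) * Suc d)"
      using le by (simp only: of_nat_le_iff)
    also have "\<dots> = real (card ((\<lambda>m. key (w m)) ` T)) * real (Suc d)" by (simp only: of_nat_mult)
    also have "\<dots> \<le> C2 * C3 * 3 * real_of_int (2 * J + 1) * 2 powr ((s2 + s3) * real n) * real (Suc d)"
      by (rule mult_right_mono[OF key_le]) simp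
    finally show "real (card (rotation_cell (log 3 2) n ` T)) \<le> C * 2 powr ((s2 + s3) * real n)"
      by (simp add: C_def mult_ac)
  qed
qed

section \<open>Entropy of blocks and rotation angle\<close>

text \<open>Indices wrap around modulo \<open>N\<close> so that a time shift is a bijection of \<open>{..<N}\<close> and
  preserves entropies exactly.\<close>
definition cyclic_block :: "nat \<Rightarrow> (nat \<Rightarrow> 's) \<Rightarrow> nat \<Rightarrow> nat \<Rightarrow> 's list" where
  "cyclic_block N s n \<omega> = map (\<lambda>t. s ((\<omega> + t) mod N)) [0..<n]"

lemma cyclic_block_add:
  "cyclic_block N s (m + n) \<omega> = cyclic_block N s m \<omega> @ cyclic_block N s n ((\<omega> + m) mod N)"
proof (rule nth_equalityI)
  fix i assume "i < length (cyclic_block N s (m + n) \<omega>)"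
  then have i: "i < m + n" by (simp add: cyclic_block_def)
  show "cyclic_block N s (m + n) \<omega> ! i = (cyclic_block N s m \<omega> @ cyclic_block N s n ((\<omega> + m) mod N)) ! i"
  proof (cases "i < m")
    case True
    then show ?thesis using i by (simp add: cyclic_block_def nth_append)
  next
    case False
    have "((\<omega> + m) mod N + (i - m)) mod N = (\<omega> + m + (i - m)) mod N" by (rule mod_add_left_eq)
    also have "\<omega> + m + (i - m) = \<omega> + i" using False by simp
    finally have "((\<omega> + m) mod N + (i - m)) mod N = (\<omega> + i) mod N" .
    moreover have "i - m < n" using i False by linarith
    ultimately show ?thesis using i False by (simp add: cyclic_block_def nth_append)
  qed
qed (simp add: cyclic_block_def)

lemma bij_betw_cyclic_shift:
  assumes "0 < (N::nat)"
  shows "bij_betw (\<lambda>\<omega>. (\<omega> + t) mod N) {..<N} {..<N}"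
proof -
  have "inj_on (\<lambda>\<omega>. (\<omega> + t) mod N) {..<N}"
  proof (rule inj_onI)
    fix x y assume "x \<in> {..<N}" "y \<in> {..<N}" "(x + t) mod N = (y + t) mod N"
    then have "int ((t + x) mod N) = int ((t + y) mod N)" by (simp add: add.commute)
    then have "(int t + int x) mod int N = (int t + int y) mod int N" by (simp only: zmod_int of_nat_add)
    then show "x = y" using mod_add_cancel_range \<open>x \<in> {..<N}\<close> \<open>y \<in> {..<N}\<close> by blast
  qed
  moreover have "(\<lambda>\<omega>. (\<omega> + t) mod N) ` {..<N} \<subseteq> {..<N}" using assms by auto
  ultimately show ?thesis
    by (simp add: bij_betw_def endo_inj_surj)
qed

text \<open>Swapping \<Theta> for its shift in the condition costs only the conditional entropy of
  the shift given \<Theta>, by submodularity; the pair shifted as a whole has unchanged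
  entropy.\<close>

lemma ent_shifted_block:
  fixes s :: "nat \<Rightarrow> 's" and \<Theta> :: "nat \<Rightarrow> 'c"
  assumes N: "0 < N" and t: "t * n \<le> N" "t \<le> N"
    and range: "card (\<Theta> ` {..<N}) \<le> 2 ^ n"
    and shift: "\<And>E v. card ((\<lambda>\<omega>. \<Theta> (\<omega> + t)) ` {\<omega>\<in>E. \<Theta> \<omega> = v}) \<le> 2"
  shows "ent {..<N} (\<lambda>\<omega>. (cyclic_block N s n ((\<omega> + t) mod N), \<Theta> \<omega>))
    \<le> ent {..<N} (\<lambda>\<omega>. (cyclic_block N s n \<omega>, \<Theta> \<omega>)) + 3 * real N"
proof -
  let ?O = "{..<N}"
  define \<sigma> where "\<sigma> = (\<lambda>\<omega>. (\<omega> + t) mod N)"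
  have bij: "bij_betw \<sigma> ?O ?O" unfolding \<sigma>_def by (rule bij_betw_cyclic_shift[OF N])
  let ?X = "cyclic_block N s n"
  \<comment> \<open>On \<open>E\<close> no index wraps around and the shift costs one bit. The other
    \<open>t\<close> times are charged \<open>n\<close> bits each, together at most
    \<open>N\<close>; the indicator of \<open>E\<close> gives the third \<open>N\<close>.\<close>
  define E where "E = {..<N - t}"
  have cE: "real (card E) = real N - real t" using t by (simp add: E_def of_nat_diff)
  have "ent ?O (\<lambda>\<omega>. (\<Theta> (\<sigma> \<omega>), \<Theta> \<omega>)) \<le> ent ?O \<Theta> + real (card ?O)
      + real (card E) * log 2 2 + (real (card ?O) - real (card E)) * log 2 (2 ^ n)"
  proof (rule ent_pair_le_event)
    fix v
    have "(\<lambda>\<omega>. \<Theta> (\<sigma> \<omega>)) ` {\<omega>\<in>E. \<Theta> \<omega> = v} = (\<lambda>\<omega>. \<Theta> (\<omega> + t)) ` {\<omega>\<in>E. \<Theta> \<omega> = v}"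
      by (rule image_cong) (auto simp: E_def \<sigma>_def)
    then show "real (card ((\<lambda>\<omega>. \<Theta> (\<sigma> \<omega>)) ` {\<omega>\<in>E. \<Theta> \<omega> = v})) \<le> 2"
      using shift[of E v] by simp
    have "(\<lambda>\<omega>. \<Theta> (\<sigma> \<omega>)) ` ?O = \<Theta> ` ?O"
      using bij by (simp add: bij_betw_def image_image[symmetric])
    then have "card ((\<lambda>\<omega>. \<Theta> (\<sigma> \<omega>)) ` ?O) \<le> 2 ^ n" using range by simp
    then have "real (card ((\<lambda>\<omega>. \<Theta> (\<sigma> \<omega>)) ` ?O)) \<le> real (2 ^ n)" by (simp only: of_nat_le_iff)
    then show "real (card ((\<lambda>\<omega>. \<Theta> (\<sigma> \<omega>)) ` ?O)) \<le> 2 ^ n" by simp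
  qed (auto simp: E_def)
  also have "\<dots> = ent ?O \<Theta> + 2 * real N - real t + real t * real n"
    by (simp add: cE log_nat_power)
  also have "\<dots> \<le> ent ?O \<Theta> + 3 * real N"
  proof -
    have "real (t * n) \<le> real N" using t(1) by (simp only: of_nat_le_iff)
    then show ?thesis by simp
  qed
  finally have 1: "ent ?O (\<lambda>\<omega>. (\<Theta> (\<sigma> \<omega>), \<Theta> \<omega>)) \<le> ent ?O \<Theta> + 3 * real N" .
  have swap: "ent ?O (\<lambda>\<omega>. (\<Theta> \<omega>, \<Theta> (\<sigma> \<omega>))) \<le> ent ?O (\<lambda>\<omega>. (\<Theta> (\<sigma> \<omega>), \<Theta> \<omega>))"
    by (rule ent_mono) auto
  have "ent ?O (\<lambda>\<omega>. (?X (\<sigma> \<omega>), \<Theta> \<omega>)) \<le> ent ?O (\<lambda>\<omega>. (?X (\<sigma> \<omega>), \<Theta> \<omega>, \<Theta> (\<sigma> \<omega>)))"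
    by (rule ent_mono) auto
  also have "\<dots> \<le> ent ?O (\<lambda>\<omega>. (?X (\<sigma> \<omega>), \<Theta> (\<sigma> \<omega>))) + ent ?O (\<lambda>\<omega>. (\<Theta> \<omega>, \<Theta> (\<sigma> \<omega>))) - ent ?O (\<lambda>\<omega>. \<Theta> (\<sigma> \<omega>))"
    using ent_submodular[of ?O "\<lambda>\<omega>. ?X (\<sigma> \<omega>)" \<Theta> "\<lambda>\<omega>. \<Theta> (\<sigma> \<omega>)"] by simp
  also have "ent ?O (\<lambda>\<omega>. (?X (\<sigma> \<omega>), \<Theta> (\<sigma> \<omega>))) = ent ?O (\<lambda>\<omega>. (?X \<omega>, \<Theta> \<omega>))"
    by (rule ent_bij[OF bij, of "\<lambda>\<omega>. (?X \<omega>, \<Theta> \<omega>)"])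
  also have "ent ?O (\<lambda>\<omega>. \<Theta> (\<sigma> \<omega>)) = ent ?O \<Theta>" by (rule ent_bij[OF bij])
  finally show ?thesis using 1 swap by (simp add: \<sigma>_def)
qed

text \<open>Conditionally on \<open>\<Theta>\<close>, each of the \<open>L\<close> consecutive blocks of length \<open>n\<close> carries essentially
  the same entropy, because \<open>\<Theta>\<close> and its shifts determine each other up to \<open>O(1)\<close> bits; the
  information about \<open>\<Theta>\<close> is therefore paid for only once.\<close>
lemma ent_long_block:
  fixes s :: "nat \<Rightarrow> 's" and \<Theta> :: "nat \<Rightarrow> 'c"
  assumes N: "0 < N" and L: "L * n * n \<le> N" "0 < n"
    and range: "card (\<Theta> ` {..<N}) \<le> 2 ^ n"
    and shift: "\<And>E v t. card ((\<lambda>\<omega>. \<Theta> (\<omega> + t)) ` {\<omega>\<in>E. \<Theta> \<omega> = v}) \<le> 2"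
  shows "ent {..<N} (cyclic_block N s (L * n)) \<le> ent {..<N} \<Theta> 
     + real L * (ent {..<N} (\<lambda>\<omega>. (cyclic_block N s n \<omega>, \<Theta> \<omega>)) + 3 * real N - ent {..<N} \<Theta>)"
proof -
  let ?O = "{..<N}" and ?X = "cyclic_block N s"
  define d where "d = ent ?O (\<lambda>\<omega>. (?X n \<omega>, \<Theta> \<omega>)) + 3 * real N - ent ?O \<Theta>"
  have "ent ?O (\<lambda>\<omega>. (?X (j * n) \<omega>, \<Theta> \<omega>)) \<le> ent ?O \<Theta> + real j * d" if "j \<le> L" for j
    using that
  proof (induction j)
    case 0
    show ?case by (simp, rule ent_mono) (auto simp: cyclic_block_def)
  next
    case (Suc j)
    let ?t = "j * n"
    let ?Y = "\<lambda>\<omega>. ?X n ((\<omega> + ?t) mod N)"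
    have "?t * n \<le> L * n * n" using Suc.prems by (intro mult_le_mono) auto
    then have t: "?t * n \<le> N" using L by linarith
    moreover have "?t * 1 \<le> ?t * n" using L(2) by (intro mult_le_mono) auto
    ultimately have t': "?t \<le> N" by linarith
    have "ent ?O (\<lambda>\<omega>. (?X (Suc j * n) \<omega>, \<Theta> \<omega>)) \<le> ent ?O (\<lambda>\<omega>. (?Y \<omega>, ?X ?t \<omega>, \<Theta> \<omega>))"
      using cyclic_block_add[of N s ?t n] by (intro ent_mono) (auto simp: add.commute[of n])
    also have "\<dots> \<le> ent ?O (\<lambda>\<omega>. (?Y \<omega>, \<Theta> \<omega>)) + ent ?O (\<lambda>\<omega>. (?X ?t \<omega>, \<Theta> \<omega>)) - ent ?O \<Theta>"
      using ent_submodular[of ?O ?Y "?X ?t" \<Theta>] by simp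
    also have "\<dots> \<le> (ent ?O (\<lambda>\<omega>. (?X n \<omega>, \<Theta> \<omega>)) + 3 * real N) + (ent ?O \<Theta> + real j * d) - ent ?O \<Theta>"
      using ent_shifted_block[OF N t t' range shift, of s] Suc by simp
    also have "\<dots> = ent ?O \<Theta> + real (Suc j) * d" by (simp add: d_def algebra_simps)
    finally show ?case .
  qed
  from this[of L] have "ent ?O (\<lambda>\<omega>. (?X (L * n) \<omega>, \<Theta> \<omega>)) \<le> ent ?O \<Theta> + real L * d" by simp
  moreover have "ent ?O (?X (L * n)) \<le> ent ?O (\<lambda>\<omega>. (?X (L * n) \<omega>, \<Theta> \<omega>))"
    by (rule ent_mono) auto
  ultimately show ?thesis unfolding d_def by linarith
qed

text \<open>Combines three estimates: the long block pays for \<Theta> once; on \<open>E\<close> the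
  short block leaves only \<open>log 2 B\<close> of the \<open>n\<close> bits of \<Theta> open; and
  by \<open>freq\<close> the entropy of \<Theta> is at least \<open>n - 2\<close> bits per time. The
  term \<open>6 * N\<close> is 3 N for shifts, N for the indicator of \<open>E\<close>, and 2 N for
  the two missing bits.\<close>

lemma event_card_le_entropy_drop:
  fixes s :: "nat \<Rightarrow> 's" and \<Theta> :: "nat \<Rightarrow> 'c"
  assumes N: "0 < N" and L: "L * n * n \<le> N" "0 < n" "0 < L"
    and range: "card (\<Theta> ` {..<N}) \<le> 2 ^ n"
    and shift: "\<And>E v t. card ((\<lambda>\<omega>. \<Theta> (\<omega> + t)) ` {\<omega>\<in>E. \<Theta> \<omega> = v}) \<le> 2"
    and freq: "\<And>c. card {\<omega>\<in>{..<N}. \<Theta> \<omega> = c} * 2 ^ n \<le> 4 * N"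
    and E: "E \<subseteq> {..<N}" and B: "1 \<le> B"
    and fib: "\<And>v. real (card (\<Theta> ` {\<omega>\<in>E. cyclic_block N s n \<omega> = v})) \<le> B"
  shows "real (card E) * (real n - log 2 B) \<le> ent {..<N} (cyclic_block N s n)
    - ent {..<N} (cyclic_block N s (L * n)) / real L + 6 * real N + real N * real n / real L"
proof -
  let ?O = "{..<N}" and ?X = "cyclic_block N s"
  define T where "T = ent ?O \<Theta>"
  define P where "P = ent ?O (\<lambda>\<omega>. (?X n \<omega>, \<Theta> \<omega>))"
  have rr: "real (card (\<Theta> ` ?O)) \<le> 2 ^ n"
    using range by (metis of_nat_le_iff of_nat_numeral of_nat_power)
  have 1: "ent ?O (?X (L * n)) \<le> T + real L * (P + 3 * real N - T)"
    unfolding T_def P_def by (rule ent_long_block[OF N L(1,2) range shift])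
  have "P \<le> ent ?O (\<lambda>\<omega>. (\<Theta> \<omega>, ?X n \<omega>))" unfolding P_def by (rule ent_mono) auto
  also have "\<dots> \<le> ent ?O (?X n) + real (card ?O) + real (card E) * log 2 B + (real (card ?O) - real (card E)) * log 2 (2 ^ n)"
    by (rule ent_pair_le_event) (use E B fib rr in auto)
  finally have 2: "P \<le> ent ?O (?X n) + real N + real (card E) * log 2 B + (real N - real (card E)) * real n"
    by (simp add: log_nat_power)
  have 3: "real N * (real n - 2) \<le> T"
  proof -
    have "real n - 2 \<le> log 2 (real (card ?O) / real (fcount ?O \<Theta> (\<Theta> \<omega>)))" if w: "\<omega> \<in> ?O" for \<omega>
    proof -
      have p: "0 < fcount ?O \<Theta> (\<Theta> \<omega>)" by (rule fcount_pos[OF _ w]) simp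
      have "real (fcount ?O \<Theta> (\<Theta> \<omega>) * 2 ^ n) \<le> real (4 * N)"
        using freq[of "\<Theta> \<omega>"] unfolding fcount_def by (simp only: of_nat_le_iff)
      then have "2 ^ n / 4 \<le> real N / real (fcount ?O \<Theta> (\<Theta> \<omega>))" using p by (simp add: field_simps)
      moreover have "0 < real N / real (fcount ?O \<Theta> (\<Theta> \<omega>))" using p N by simp
      ultimately have "log 2 (2 ^ n / 4) \<le> log 2 (real N / real (fcount ?O \<Theta> (\<Theta> \<omega>)))"
        by (subst log_le_cancel_iff) auto
      moreover have "log 2 (2 ^ n / 4) = real n - 2"
      proof -
        have "log 2 (4::real) = log 2 (2 ^ 2)" by simp
        then have "log 2 (4::real) = 2" by (simp only: log_nat_power) simp
        then show ?thesis by (simp add: log_divide log_nat_power)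
      qed
      ultimately show ?thesis by simp
    qed
    from sum_mono[OF this, of ?O] show ?thesis unfolding T_def ent_def by simp
  qed
  have "T \<le> real (card ?O) * log 2 (2 ^ n)"
    unfolding T_def by (rule ent_le_log_card) (use rr in auto)
  then have "T \<le> real N * real n" by (simp add: log_nat_power)
  then have 4: "T / real L \<le> real N * real n / real L" using L by (intro divide_right_mono) auto
  have "ent ?O (?X (L * n)) / real L \<le> (T + real L * (P + 3 * real N - T)) / real L"
    using 1 L by (intro divide_right_mono) auto
  also have "\<dots> = T / real L + P + 3 * real N - T" using L by (simp add: field_simps)
  finally have 5: "ent ?O (?X (L * n)) / real L \<le> real N * real n / real L + P + 3 * real N - T"
    using 4 by linarith
  show ?thesis using 2 3 5 by (simp add: algebra_simps)
qed

text \<open>Otherwise \<open>K\<close> consecutive drops would sum to more than \<open>M\<close>,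
  making \<open>a K\<close> negative. Selects a block length at which the entropy rate hardly
  falls.\<close>

lemma small_drop:
  fixes a :: "nat \<Rightarrow> real"
  assumes K: "0 < K" and nonneg: "\<And>i. 0 \<le> a i" and a0: "a 0 \<le> M"
  obtains i where "i < K" "a i - a (Suc i) \<le> M / real K"
proof (rule ccontr)
  assume "\<not> thesis"
  then have "\<not> (\<exists>i<K. a i - a (Suc i) \<le> M / real K)" using that by blast
  then have "\<forall>i<K. M / real K < a i - a (Suc i)" by (simp add: not_le)
  then have "(\<Sum>i<K. M / real K) < (\<Sum>i<K. a i - a (Suc i))"
    using K by (intro sum_strict_mono) auto
  also have "\<dots> = a 0 - a K" by (rule sum_lessThan_telescope')
  also have "\<dots> \<le> M" using nonneg[of K] a0 by linarith
  finally show False using K by simp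
qed

lemma ent_cyclic_block_le:
  assumes N: "0 < N" and S: "finite S" "1 \<le> card S" "real (card S) \<le> 2 ^ b" "\<And>\<omega>. \<omega> < N \<Longrightarrow> s \<omega> \<in> S"
  shows "ent {..<N} (cyclic_block N s n) \<le> real N * (real b * real n)"
proof -
  have "cyclic_block N s n ` {..<N} \<subseteq> {xs. set xs \<subseteq> S \<and> length xs = n}"
    using S(4) N by (auto simp: cyclic_block_def)
  then have "card (cyclic_block N s n ` {..<N}) \<le> card S ^ n"
    using card_mono[OF finite_lists_length_eq[OF S(1), of n]] card_lists_length_eq[OF S(1), of n] by metis
  then have "real (card (cyclic_block N s n ` {..<N})) \<le> real (card S) ^ n"
    by (metis of_nat_le_iff of_nat_power)
  also have "\<dots> \<le> (2 ^ b) ^ n" using S by (intro power_mono) auto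
  finally have "real (card (cyclic_block N s n ` {..<N})) \<le> 2 ^ (b * n)" by (simp add: power_mult)
  then have "ent {..<N} (cyclic_block N s n) \<le> real (card {..<N}) * log 2 (2 ^ (b * n))"
    by (intro ent_le_log_card) auto
  then show ?thesis by (simp add: log_nat_power)
qed

section \<open>Uniform super sparseness\<close>

lemma hausdorff_dim_nonneg:
  assumes "A \<subseteq> {0..1}"
  shows "0 \<le> hausdorff_dim A"
proof (rule ccontr)
  assume "\<not> 0 \<le> hausdorff_dim A"
  then have "hausdorff_dim A < 0" by simp
  from hausdorff_dim_less_imp_null[OF assms this] show False by (metis less_asym)
qed

lemma adic_symbols_close:
  fixes a a' :: real and k N n :: nat
  defines "s \<equiv> \<lambda>\<omega>. (adic_symbol 2 id a (k + \<omega>), adic_symbol 3 ternary_level a' (k + \<omega>))"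
  assumes eq: "cyclic_block N s n \<omega> = cyclic_block N s n \<omega>'" and w: "\<omega> + n \<le> N" "\<omega>' + n \<le> N"
  shows "\<bar>frac (2 ^ (k + \<omega>) * a) - frac (2 ^ (k + \<omega>') * a)\<bar> \<le> 1 / 2 ^ n"
    and "\<bar>frac (3 ^ ternary_level (k + \<omega>) * a') - frac (3 ^ ternary_level (k + \<omega>') * a')\<bar> \<le> 3 / 2 ^ n"
proof -
  \<comment> \<open>The blocks end before \<open>N\<close>, so the cyclic indices are true
    times.\<close>
  have s: "s (\<omega> + i) = s (\<omega>' + i)" if "i < n" for i
  proof -
    have "cyclic_block N s n \<omega> ! i = cyclic_block N s n \<omega>' ! i" using eq by simp
    then show ?thesis using that w by (simp add: cyclic_block_def)
  qed
  have s2: "adic_symbol 2 id a (k + \<omega> + i) = adic_symbol 2 id a (k + \<omega>' + i)" if "i < n" for i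
    using s[OF that] by (simp add: s_def add.assoc)
  have s3: "adic_symbol 3 ternary_level a' (k + \<omega> + i) = adic_symbol 3 ternary_level a' (k + \<omega>' + i)" if "i < n" for i
    using s[OF that] by (simp add: s_def add.assoc)
  show "\<bar>frac (2 ^ (k + \<omega>) * a) - frac (2 ^ (k + \<omega>') * a)\<bar> \<le> 1 / 2 ^ n"
    using adic_symbol_eq_imp_close[of 2 id n a "k + \<omega>" "k + \<omega>'"] s2 by simp
  let ?q = "ternary_level (k + \<omega> + n) - ternary_level (k + \<omega>)"
  have mono: "ternary_level m \<le> ternary_level (Suc m)" for m
    using ternary_level_Suc[of m] by auto
  have "\<bar>frac (3 ^ ternary_level (k + \<omega>) * a') - frac (3 ^ ternary_level (k + \<omega>') * a')\<bar> \<le> 1 / 3 ^ ?q"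
    using adic_symbol_eq_imp_close[of 3 ternary_level n a' "k + \<omega>" "k + \<omega>'", OF _ mono s3, THEN conjunct2]
    by simp
  also have "\<dots> \<le> 3 / 2 ^ n"
  proof -
    have le: "ternary_level (k + \<omega>) \<le> ternary_level (k + \<omega> + n)"
      by (induction n) (auto intro: order_trans mono)
    have "2 ^ (k + \<omega>) * (2::real) ^ n < 3 * 3 ^ ternary_level (k + \<omega> + n)"
      using ternary_level_bounds(2)[of "k + \<omega> + n"] by (simp add: power_add)
    also have "\<dots> = 3 ^ ternary_level (k + \<omega>) * (3 * 3 ^ ?q)"
      using le by (simp add: power_add[symmetric])
    also have "\<dots> \<le> 2 ^ (k + \<omega>) * (3 * 3 ^ ?q)"
      using ternary_level_bounds(1)[of "k + \<omega>"] by (intro mult_right_mono) auto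
    finally have "(2::real) ^ n < 3 * 3 ^ ?q" by simp
    then show ?thesis by (simp add: field_simps)
  qed
  finally show "\<bar>frac (3 ^ ternary_level (k + \<omega>) * a') - frac (3 ^ ternary_level (k + \<omega>') * a')\<bar> \<le> 3 / 2 ^ n" .
qed

lemma sparse_index_uniform:
  assumes inv2: "times_p_invariant 2 A2" and inv3: "times_p_invariant 3 A3"
    and dim: "hausdorff_dim A2 + hausdorff_dim A3 < 1" and g: "0 < \<gamma>" and \<epsilon>: "0 < \<epsilon>"
  shows "\<exists>N0::nat. \<forall>u v a (k::nat) (N::nat).
            \<gamma> < \<bar>u\<bar> \<and> \<bar>u\<bar> < 1 / \<gamma> \<and> a \<in> slice A2 A3 u v \<and> N0 \<le> N \<longrightarrow>
            real (card (sparse_index_at (slice A2 A3 u v) a \<inter> {k+1..k+N})) \<le> \<epsilon> * real N"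
proof -
  have d0: "0 \<le> hausdorff_dim A2" "0 \<le> hausdorff_dim A3"
    using inv2 inv3 by (auto simp: times_p_invariant_def intro: hausdorff_dim_nonneg)
  \<comment> \<open>A third of the dimension gap: one third enlarges each exponent, and one third
    remains below 1.\<close>
  define \<tau> where "\<tau> = (1 - hausdorff_dim A2 - hausdorff_dim A3) / 3"
  define s2 where "s2 = hausdorff_dim A2 + \<tau>"
  define s3 where "s3 = hausdorff_dim A3 + \<tau>"
  have \<tau>: "0 < \<tau>" and s2: "hausdorff_dim A2 < s2" and s3: "hausdorff_dim A3 < s3"
    using dim by (auto simp: \<tau>_def s2_def s3_def)
  have s23: "0 \<le> s2 + s3" "1 - (s2 + s3) = \<tau>"
    using d0 \<tau> by (auto simp: s2_def s3_def \<tau>_def field_simps)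
  obtain C where C: "1 \<le> C"
    "\<And>u v a a' n T. \<gamma> < \<bar>u\<bar> \<Longrightarrow> \<bar>u\<bar> < 1 / \<gamma> \<Longrightarrow> a = u * a' + v \<Longrightarrow> finite T \<Longrightarrow>
       T \<subseteq> sparse_index_at (slice A2 A3 u v) a \<Longrightarrow>
       (\<And>m m'. m \<in> T \<Longrightarrow> m' \<in> T \<Longrightarrow> \<bar>frac (2 ^ m * a) - frac (2 ^ m' * a)\<bar> \<le> 1 / 2 ^ n) \<Longrightarrow>
       (\<And>m m'. m \<in> T \<Longrightarrow> m' \<in> T \<Longrightarrow>
          \<bar>frac (3 ^ ternary_level m * a') - frac (3 ^ ternary_level m' * a')\<bar> \<le> 3 / 2 ^ n) \<Longrightarrow>
       real (card (rotation_cell (log 3 2) n ` T)) \<le> C * 2 powr ((s2 + s3) * real n)"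
    using slope_cells_card[OF inv2 inv3 s2 s3 g] by blast
  \<comment> \<open>Three error terms, each at most \<eta> n N, add up to the product of
    (\<epsilon>/2) N and (\<tau>/2) n.\<close>
  define \<eta> where "\<eta> = \<epsilon> * \<tau> / 12"
  have \<eta>: "0 < \<eta>" using \<epsilon> \<tau> by (simp add: \<eta>_def)
  obtain K :: nat where K: "5 / \<eta> + 1 \<le> real K" using real_arch_simple by blast
  obtain L :: nat where L: "1 / \<eta> + 1 \<le> real L" using real_arch_simple by blast
  obtain n0 :: nat where n0: "6 / \<eta> + 2 * log 2 C / \<tau> + 1 \<le> real n0" using real_arch_simple by blast
  have lC: "0 \<le> log 2 C" using C(1) by simp
  have "0 < 5 / \<eta>" "0 < 1 / \<eta>" "0 < 6 / \<eta>" "0 \<le> 2 * log 2 C / \<tau>" using \<eta> \<tau> lC by simp_all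
  then have ge: "5 / \<eta> \<le> real K" "1 / \<eta> \<le> real L" "6 / \<eta> \<le> real n0" "2 * log 2 C / \<tau> \<le> real n0"
    and "0 < real K" "0 < real L" "0 < real n0"
    using K L n0 by linarith+
  then have pos: "0 < K" "0 < L" "0 < n0" by simp_all
  with ge have K': "5 / real K \<le> \<eta>" and L': "1 / real L \<le> \<eta>" and n0': "6 \<le> \<eta> * real n0" "log 2 C \<le> \<tau> / 2 * real n0"
    using \<eta> \<tau> by (simp_all add: field_simps)
  define nn where "nn = (\<lambda>i. L ^ i * n0)"
  define nmax where "nmax = L ^ K * n0"
  have "\<exists>N1. \<forall>N\<ge>N1. \<forall>k c. card {\<omega>\<in>{..<N}. rotation_cell (log 3 2) n (k + \<omega>) = c} * 2 ^ n \<le> 4 * N" for n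
    using rotation_cell_frequency[OF log_3_2_irrational, of n] by metis
  then obtain N1 where N1: "\<And>n N k c. N1 n \<le> N \<Longrightarrow> card {\<omega>\<in>{..<N}. rotation_cell (log 3 2) n (k + \<omega>) = c} * 2 ^ n \<le> 4 * N"
    by metis
  \<comment> \<open>The block length chosen later depends on the orbit and on \<open>N\<close>, so
    all \<open>K\<close> candidates are served at once. The summands secure the frequency bound,
    \<open>L * n * n \<le> N\<close>, and a discarded end of at most (\<epsilon>/2) N times.\<close>
  define N0 where "N0 = (\<Sum>i<K. N1 (nn i)) + L * nmax * nmax + nat \<lceil>2 * real nmax / \<epsilon>\<rceil> + 1"
  show ?thesis
  proof (intro exI[of _ N0] allI impI, elim conjE)
    fix u v a :: real and k N :: nat
    assume u: "\<gamma> < \<bar>u\<bar>" "\<bar>u\<bar> < 1 / \<gamma>" and a_in: "a \<in> slice A2 A3 u v" and N: "N0 \<le> N"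
    obtain a' where a: "a = u * a' + v" using a_in by (auto simp: slice_def)
    define W where "W = sparse_index_at (slice A2 A3 u v) a"
    define s where "s = (\<lambda>\<omega>. (adic_symbol 2 id a (k + 1 + \<omega>), adic_symbol 3 ternary_level a' (k + 1 + \<omega>)))"
    have Npos: "0 < N" using N by (simp add: N0_def)
    define S :: "((nat \<times> int) \<times> (nat \<times> int)) set" where "S = ({0, 1} \<times> {0..<int 2}) \<times> ({0, 1} \<times> {0..<int 3})"
    have sS: "s \<omega> \<in> S" for \<omega>
      unfolding s_def S_def
      by (intro SigmaI adic_symbol_range ternary_level_Suc) auto
    \<comment> \<open>There are 4 * 6 = 24 symbols, hence five bits per time; this is the 5 in the
      choice of \<open>K\<close>.\<close>
    have cS: "finite S" "1 \<le> card S" "real (card S) \<le> 2 ^ 5"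
      unfolding S_def by (simp_all add: card_cartesian_product)
    \<comment> \<open>Entropy per symbol of the block, summed over the \<open>N\<close> starting
      times. It lies between 0 and 5 N at \<open>i = 0\<close>, so one of the first \<open>K\<close>
      drops is at most 5 N / K.\<close>
    define h where "h = (\<lambda>i. ent {..<N} (cyclic_block N s (nn i)) / real (nn i))"
    have nnpos: "0 < nn i" for i using pos by (simp add: nn_def)
    have "0 \<le> h i" for i unfolding h_def by (intro divide_nonneg_nonneg ent_nonneg) auto
    moreover have "h 0 \<le> 5 * real N"
      using ent_cyclic_block_le[OF Npos cS sS, where n = "nn 0"] nnpos[of 0] by (simp add: h_def field_simps)
    ultimately obtain i where i: "i < K" "h i - h (Suc i) \<le> 5 * real N / real K"
      using small_drop[OF pos(1)] by metis
    define n where "n = nn i"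
    have n: "0 < n" "n0 \<le> n" "n \<le> nmax" "nn (Suc i) = L * n"
      using pos i(1) by (auto simp: n_def nn_def nmax_def intro: power_increasing)
    define \<Theta> where "\<Theta> = (\<lambda>\<omega>. rotation_cell (log 3 2) n (k + 1 + \<omega>))"
    \<comment> \<open>The last \<open>n\<close> starting times are left out so that no block wraps
      around; they are added back at the end.\<close>
    define E where "E = {\<omega>\<in>{..<N - n}. k + 1 + \<omega> \<in> W}"
    define B where "B = C * 2 powr ((s2 + s3) * real n)"
    have "L * n * n \<le> L * nmax * nmax" using n by (intro mult_le_mono) auto
    then have LN: "L * n * n \<le> N" using N unfolding N0_def by linarith
    have N1N: "N1 n \<le> N"
    proof -
      have "N1 (nn i) \<le> (\<Sum>i<K. N1 (nn i))" using i(1) by (intro member_le_sum) auto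
      then show ?thesis using N by (simp add: N0_def n_def)
    qed
    have nN: "real n \<le> \<epsilon> / 2 * real N"
    proof -
      have "2 * real nmax / \<epsilon> \<le> real N" using N unfolding N0_def by linarith
      then have "real nmax \<le> \<epsilon> / 2 * real N" using \<epsilon> by (simp add: field_simps)
      then show ?thesis using n(3) by linarith
    qed
    have B1: "1 \<le> B"
    proof -
      have "1 * 1 \<le> B" unfolding B_def using C(1) s23 by (intro mult_mono ge_one_powr_ge_zero) auto
      then show ?thesis by simp
    qed
    have logB: "log 2 B = log 2 C + (s2 + s3) * real n"
      using C(1) by (simp add: B_def log_mult)
    have fib: "real (card (\<Theta> ` {\<omega>\<in>E. cyclic_block N s n \<omega> = w})) \<le> B" for w
    proof -
      define T where "T = (\<lambda>\<omega>. k + 1 + \<omega>) ` {\<omega>\<in>E. cyclic_block N s n \<omega> = w}"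
      have fT: "finite T" by (simp add: T_def E_def)
      have TW: "T \<subseteq> sparse_index_at (slice A2 A3 u v) a" by (auto simp: T_def E_def W_def)
      have "real (card (rotation_cell (log 3 2) n ` T)) \<le> B"
        unfolding B_def
      proof (rule C(2)[OF u a fT TW])
        fix m m' assume "m \<in> T" "m' \<in> T"
        then obtain \<omega> \<omega>' where w: "m = k + 1 + \<omega>" "m' = k + 1 + \<omega>'" "\<omega> + n \<le> N" "\<omega>' + n \<le> N"
          "cyclic_block N s n \<omega> = cyclic_block N s n \<omega>'"
          by (auto simp: T_def E_def)
        note cl = adic_symbols_close[OF w(5)[unfolded s_def] w(3,4)]
        show "\<bar>frac (2 ^ m * a) - frac (2 ^ m' * a)\<bar> \<le> 1 / 2 ^ n"
          using cl(1) by (simp only: w(1,2))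
        show "\<bar>frac (3 ^ ternary_level m * a') - frac (3 ^ ternary_level m' * a')\<bar> \<le> 3 / 2 ^ n"
          using cl(2) by (simp only: w(1,2))
      qed
      moreover have "rotation_cell (log 3 2) n ` T = \<Theta> ` {\<omega>\<in>E. cyclic_block N s n \<omega> = w}"
        by (simp add: T_def \<Theta>_def image_image)
      ultimately show ?thesis by simp
    qed
    have main: "real (card E) * (real n - log 2 B) \<le> ent {..<N} (cyclic_block N s n)
      - ent {..<N} (cyclic_block N s (L * n)) / real L + 6 * real N + real N * real n / real L"
    proof (rule event_card_le_entropy_drop[where \<Theta> = \<Theta>])
      have "\<Theta> ` {..<N} \<subseteq> {0..<2 ^ n}" unfolding \<Theta>_def using rotation_cell_range by blast
      then have "card (\<Theta> ` {..<N}) \<le> card {0..<2 ^ n :: int}" by (rule card_mono[rotated]) simp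
      then show "card (\<Theta> ` {..<N}) \<le> 2 ^ n" by (simp add: nat_power_eq)
      show "card ((\<lambda>\<omega>. \<Theta> (\<omega> + t)) ` {\<omega>\<in>E. \<Theta> \<omega> = v}) \<le> 2" for E v t
        using rotation_cell_shift_card[of "log 3 2" n "k + 1" t E v] by (simp add: \<Theta>_def add.assoc)
      show "card {\<omega>\<in>{..<N}. \<Theta> \<omega> = c} * 2 ^ n \<le> 4 * N" for c
        using N1[OF N1N, of "k + 1" c] by (simp add: \<Theta>_def)
    qed (use Npos LN n(1) pos(2) B1 fib in \<open>auto simp: E_def\<close>)
    have "ent {..<N} (cyclic_block N s n) - ent {..<N} (cyclic_block N s (L * n)) / real L
        = real n * (h i - h (Suc i))"
      using n(1,4) pos(2) by (simp add: h_def n_def[symmetric] field_simps)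
    also have "\<dots> \<le> real n * (5 * real N / real K)" using i(2) by (intro mult_left_mono) auto
    finally have drop: "ent {..<N} (cyclic_block N s n) - ent {..<N} (cyclic_block N s (L * n)) / real L
        \<le> real n * real N * (5 / real K)" by (simp add: mult_ac)
    \<comment> \<open>On \<open>E\<close> the digit block must reveal a fixed proportion of the
      angle: of the spare \<tau> n bits, half absorbs the constant \<open>C\<close>.\<close>
    have gap: "\<tau> / 2 * real n \<le> real n - log 2 B"
    proof -
      have "\<tau> / 2 * real n0 \<le> \<tau> / 2 * real n" using n(2) \<tau> by (intro mult_left_mono) auto
      then have "log 2 C \<le> \<tau> / 2 * real n" using n0'(2) by linarith
      moreover have "real n - (s2 + s3) * real n = \<tau> * real n" by (simp add: s23(2)[symmetric] left_diff_distrib)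
      ultimately show ?thesis by (simp add: logB)
    qed
    have "real (card E) * (\<tau> / 2 * real n) \<le> real (card E) * (real n - log 2 B)"
      using gap by (intro mult_left_mono) auto
    also have "\<dots> \<le> real n * real N * (5 / real K) + 6 * real N + real n * real N * (1 / real L)"
      using main drop by (simp add: mult.commute)
    also have "\<dots> \<le> real n * real N * \<eta> + real n * real N * \<eta> + real n * real N * \<eta>"
    proof (intro add_mono)
      have "\<eta> * real n0 \<le> \<eta> * real n" using n(2) \<eta> by (intro mult_left_mono) auto
      then have "6 \<le> \<eta> * real n" using n0'(1) by linarith
      then have "6 * real N \<le> (\<eta> * real n) * real N" by (rule mult_right_mono) simp
      then show "6 * real N \<le> real n * real N * \<eta>" by (simp add: mult_ac)
      show "real n * real N * (5 / real K) \<le> real n * real N * \<eta>"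
        using K' by (rule mult_left_mono) simp
      show "real n * real N * (1 / real L) \<le> real n * real N * \<eta>"
        using L' by (rule mult_left_mono) simp
    qed
    also have "\<dots> = (\<epsilon> / 2 * real N) * (\<tau> / 2 * real n)" by (simp add: \<eta>_def)
    finally have cE: "real (card E) \<le> \<epsilon> / 2 * real N"
      using \<tau> n(1) by (simp add: mult_le_cancel_right)
    have "W \<inter> {k+1..k+N} \<subseteq> (\<lambda>\<omega>. k + 1 + \<omega>) ` E \<union> {k + 1 + (N - n)..k + N}"
    proof
      fix m assume m: "m \<in> W \<inter> {k+1..k+N}"
      show "m \<in> (\<lambda>\<omega>. k + 1 + \<omega>) ` E \<union> {k + 1 + (N - n)..k + N}"
      proof (cases "m < k + 1 + (N - n)")
        case True
        then have "m - (k + 1) \<in> E" "m = k + 1 + (m - (k + 1))" using m by (auto simp: E_def)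
        then show ?thesis by blast
      next
        case False
        then show ?thesis using m by simp
      qed
    qed
    then have "card (W \<inter> {k+1..k+N}) \<le> card ((\<lambda>\<omega>. k + 1 + \<omega>) ` E \<union> {k + 1 + (N - n)..k + N})"
      by (rule card_mono[rotated]) (simp add: E_def)
    also have "\<dots> \<le> card ((\<lambda>\<omega>. k + 1 + \<omega>) ` E) + card {k + 1 + (N - n)..k + N}"
      by (rule card_Un_le)
    also have "\<dots> \<le> card E + n"
      by (intro add_mono card_image_le) (auto simp: E_def)
    finally show "real (card (sparse_index_at (slice A2 A3 u v) a \<inter> {k+1..k+N})) \<le> \<epsilon> * real N"
      using cE nN unfolding W_def by linarith
  qed
qed

section \<open>From uniform counts to Banach density\<close>

lemma upper_banach_density_eq_0:
  assumes "\<And>\<epsilon>. 0 < \<epsilon> \<Longrightarrow> \<exists>N0. \<forall>k. \<forall>N\<ge>N0. real (card (W \<inter> {k+1..k+N})) \<le> \<epsilon> * real N"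
  shows "upper_banach_density W = 0"
proof -
  define f where "f = (\<lambda>N. SUP k. real (card (W \<inter> {k+1..k+N})) / real N)"
  have "f \<longlonglongrightarrow> 0"
  proof (rule LIMSEQ_I)
    fix r :: real assume r: "0 < r"
    obtain N0 where N0: "\<And>k N. N0 \<le> N \<Longrightarrow> real (card (W \<inter> {k+1..k+N})) \<le> r / 2 * real N"
      using assms[of "r / 2"] r by auto
    show "\<exists>no. \<forall>N\<ge>no. norm (f N - 0) < r"
    \<comment> \<open>\<open>Suc N0\<close> keeps \<open>N\<close> positive, so the estimate may be
      divided by \<open>N\<close>.\<close>
    proof (intro exI[of _ "Suc N0"] allI impI)
      fix N assume N: "Suc N0 \<le> N"
      have le: "real (card (W \<inter> {k+1..k+N})) / real N \<le> r / 2" for k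
        using N0[of N k] N by (simp add: field_simps)
      then have "f N \<le> r / 2" unfolding f_def by (intro cSUP_least) auto
      \<comment> \<open>A real-valued supremum dominates its members only over a bounded family;
        \<open>le\<close> provides the bound.\<close>
      moreover have "0 \<le> f N"
      proof -
        have "bdd_above (range (\<lambda>k. real (card (W \<inter> {k+1..k+N})) / real N))"
          using le by (intro bdd_aboveI2)
        then have "real (card (W \<inter> {0+1..0+N})) / real N \<le> f N"
          unfolding f_def by (rule cSUP_upper2[where x = 0]) auto
        then show ?thesis by (rule order_trans[rotated]) simp
      qed
      ultimately show "norm (f N - 0) < r" using r by simp
    qed
  qed
  then have "(\<lambda>N. ereal (f N)) \<longlonglongrightarrow> ereal 0" by (rule tendsto_ereal)
  then have "limsup (\<lambda>N. ereal (f N)) = ereal 0" by (rule lim_imp_Limsup[OF sequentially_bot])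
  then show ?thesis by (simp add: upper_banach_density_def f_def zero_ereal_def)
qed

theorem theorem8p4:
  fixes A2 A3 :: "real set"
  assumes "times_p_invariant 2 A2"
    and "times_p_invariant 3 A3"
    and "hausdorff_dim A2 + hausdorff_dim A3 < 1"
  shows "(\<forall>u v a. u \<noteq> 0 \<longrightarrow> a \<in> slice A2 A3 u v \<longrightarrow> super_sparse_near (slice A2 A3 u v) a)
       \<and> (\<forall>\<gamma>>0. \<forall>\<epsilon>>0. \<exists>N0::nat. \<forall>u v a (k::nat) (N::nat).
            \<gamma> < \<bar>u\<bar> \<and> \<bar>u\<bar> < 1 / \<gamma> \<and> a \<in> slice A2 A3 u v \<and> N0 \<le> N \<longrightarrow>
            real (card (sparse_index_at (slice A2 A3 u v) a \<inter> {k+1..k+N})) \<le> \<epsilon> * real N)"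
proof (intro conjI allI impI)
  fix u v a :: real assume u: "u \<noteq> 0" and a: "a \<in> slice A2 A3 u v"
  \<comment> \<open>Halving makes both inequalities of the slope window strict.\<close>
  define \<gamma> where "\<gamma> = min \<bar>u\<bar> (1 / \<bar>u\<bar>) / 2"
  have half_min: "min x y / 2 < y" if "0 < y" for x y :: real
    using that by (auto simp: min_def)
  have g: "0 < \<gamma>" "\<gamma> < \<bar>u\<bar>" using u by (auto simp: \<gamma>_def min_def)
  have "0 < 1 / \<bar>u\<bar>" using u by simp
  then have "\<gamma> < 1 / \<bar>u\<bar>"
    unfolding \<gamma>_def by (rule half_min)
  then have g': "\<bar>u\<bar> < 1 / \<gamma>" using g u by (simp add: field_simps)
  show "super_sparse_near (slice A2 A3 u v) a"
    unfolding super_sparse_near_def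
    using sparse_index_uniform[OF assms g(1)] g(2) g' a by (intro upper_banach_density_eq_0) metis
qed (rule sparse_index_uniform[OF assms])

end
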